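(* Let $\tau>0$ and $\mathbb B_\tau=[-1/\tau,1/\tau]^d$. Let $K_{\mathrm{mod}}(s,t)=\rho_{\mathrm{mod}}(s-t)$ be a translation-invariant reproducing kernel on $\mathbb R^d$ with a non-zero Fourier transform on the low frequencies $\mathbb B_\tau$. Then $$C_{\mathrm{switch}}(\Psi_\tau,\rho_{\mathrm{mod}})=\operatorname*{ess\,sup}_{\omega\in\mathbb B_\tau}\sqrt{\frac{\mathfrak F[\Psi_\tau]}{\mathfrak F[\rho_{\mathrm{mod}}]}(\omega)}\le\frac{\operatorname*{ess\,sup}_{\omega\in\mathbb B_\tau}\sqrt{\mathfrak F[\Psi_\tau](\omega)}}{\operatorname*{ess\,inf}_{\omega\in\mathbb B_\tau}\sqrt{\mathfrak F[\rho_{\mathrm{mod}}](\omega)}},$$ and if $\mathfrak F[\rho_{\mathrm{mod}}]$ is bounded away from $0$ almost everywhere on low frequencies, i.e. $\operatorname*{ess\,inf}_{\mathbb B_\tau}\mathfrak F[\rho_{\mathrm{mod}}]>0$, then $C_{\mathrm{switch}}(\Psi_\tau,\rho_{\mathrm{mod}})<+\infty$ and the RKHS $\mathcal H_{\text{sinc-4}}$ of $(s,t)\mapsto\Psi_\tau(s-t)$ continuously embeds into the RKHS $\mathcal H_{\rho_{\mathrm{mod}}}$ of $K_{\mathrm{mod}}$.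
   Context: Fourier transform: $\mathfrak F[g](\omega)=\int_{\mathbb R^d}g(z)e^{-\imath\omega^\top z}dz$. The sinc-4 function is $\Psi_\tau(u)=\prod_{i=1}^d\Big(\frac{\sin(u_i/(4\tau))}{u_i/(4\tau)}\Big)^4$; its Fourier transform is supported on $\mathbb B_\tau$. Kernels are continuous, with $\rho(u)=\frac1{(2\pi)^d}\int e^{\imath\omega^\top u}\mathfrak F[\rho](\omega)\,d\omega$, $\mathfrak F[\rho]\ge0$. The RKHS of a translation-invariant kernel $\rho$ on $\mathbb R^d$ is $\mathcal H_\rho=\{g\in L^2(\mathbb R^d):\|g\|_{\mathcal H_\rho}^2=\frac1{(2\pi)^d}\int\frac{|\mathfrak F[g]|^2}{\mathfrak F[\rho]}<\infty\}$ (convention $0/0=0$). For two kernels with RKHSs $\mathcal H_{\mathrm{pivot}}$, $\mathcal H_{\mathrm{mod}}$, $C_{\mathrm{switch}}=\sup_{\eta\in\mathcal H_{\mathrm{pivot}}\setminus\{0\}}\|\eta\|_{\mathcal H_{\mathrm{mod}}}/\|\eta\|_{\mathcal H_{\mathrm{pivot}}}$ is the operator norm of the identity map $\mathcal H_{\mathrm{pivot}}\to\mathcal H_{\mathrm{mod}}$ (with value $+\infty$ if $\mathcal H_{\mathrm{pivot}}\not\subseteq\mathcal H_{\mathrm{mod}}$); $C_{\mathrm{switch}}(\Psi_\tau,\rho_{\mathrm{mod}})$ is this constant for the pivot kernel $\Psi_\tau$ and the model kernel $\rho_{\mathrm{mod}}$. *)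

theory Defs
  imports "HOL-Probability.Essential_Supremum" "HOL-Probability.Sinc_Integral"
begin

section \<open>Fourier transform\<close>

definition fourier_integral :: "(real ^ 'n \<Rightarrow> complex) \<Rightarrow> real ^ 'n \<Rightarrow> complex" where
  "fourier_integral g \<omega> = (LINT z|lborel. g z * exp (- \<i> * of_real (\<omega> \<bullet> z)))"

definition inverse_fourier_integral :: "(real ^ 'n \<Rightarrow> complex) \<Rightarrow> real ^ 'n \<Rightarrow> complex" where
  "inverse_fourier_integral h u =
     of_real (1 / (2 * pi) ^ CARD('n)) * (LINT \<omega>|lborel. exp (\<i> * of_real (\<omega> \<bullet> u)) * h \<omega>)"

definition square_integrable :: "(real ^ 'n \<Rightarrow> complex) \<Rightarrow> bool" where
  "square_integrable g \<longleftrightarrow>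
     g \<in> borel_measurable lborel \<and> (\<integral>\<^sup>+ z. ennreal ((cmod (g z))\<^sup>2) \<partial>lborel) < \<infinity>"

text \<open>The Plancherel transform of a square-integrable function as a limit in the mean:
  \<open>h\<close> is the \<open>L\<^sup>2\<close>-limit of the Fourier integrals of \<open>g\<close> truncated to growing balls.\<close>

definition is_L2_fourier :: "(real ^ 'n \<Rightarrow> complex) \<Rightarrow> (real ^ 'n \<Rightarrow> complex) \<Rightarrow> bool" where
  "is_L2_fourier g h \<longleftrightarrow> square_integrable h \<and>
     (\<lambda>n::nat. \<integral>\<^sup>+ \<omega>. ennreal ((cmod
        (fourier_integral (\<lambda>z. if norm z \<le> real n then g z else 0) \<omega> - h \<omega>))\<^sup>2) \<partial>lborel)
     \<longlonglongrightarrow> 0"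

text \<open>The Fourier integral itself for integrable functions, extended to square-integrable
  functions by limits in the mean.  The last clause is for kernels that lie in neither space but
  are the inverse Fourier integral of an integrable spectral density; that density is then the
  Fourier transform.  The last two clauses determine the transform up to null sets, and the three
  clauses agree almost everywhere where they overlap.\<close>

definition fourier :: "(real ^ 'n \<Rightarrow> complex) \<Rightarrow> real ^ 'n \<Rightarrow> complex" where
  "fourier g =
     (if integrable lborel g then fourier_integral g
      else if square_integrable g then SOME h. is_L2_fourier g h
      else SOME h. integrable lborel h \<and> (\<forall>u. g u = inverse_fourier_integral h u))"


section \<open>Translation-invariant kernels and their reproducing kernel Hilbert spaces\<close>

text \<open>The kernel is \<open>K s t = \<rho> (s - t)\<close>.  That it is positive semidefinite is a consequence of the
  conditions, see \<open>translation_invariant_kernel_psd\<close> below.\<close>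

definition translation_invariant_kernel :: "(real ^ 'n \<Rightarrow> complex) \<Rightarrow> bool" where
  "translation_invariant_kernel \<rho> \<longleftrightarrow>
     continuous_on UNIV \<rho> \<and>
     integrable lborel (fourier \<rho>) \<and>
     (AE \<omega> in lborel. Im (fourier \<rho> \<omega>) = 0 \<and> 0 \<le> Re (fourier \<rho> \<omega>)) \<and>
     (\<forall>u. \<rho> u = inverse_fourier_integral (fourier \<rho>) u)"

text \<open>Division on \<^typ>\<open>ennreal\<close> satisfies \<open>0 / 0 = 0\<close> and \<open>x / 0 = \<infinity>\<close> for \<open>x > 0\<close>.\<close>

definition rkhs_norm_sq :: "(real ^ 'n \<Rightarrow> complex) \<Rightarrow> (real ^ 'n \<Rightarrow> complex) \<Rightarrow> ennreal" where
  "rkhs_norm_sq \<rho> g = ennreal (1 / (2 * pi) ^ CARD('n)) *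
     (\<integral>\<^sup>+ \<omega>. ennreal ((cmod (fourier g \<omega>))\<^sup>2) / ennreal (Re (fourier \<rho> \<omega>)) \<partial>lborel)"

text \<open>Elements of \<open>L\<^sup>2\<close> are represented by measurable functions, so the zero vector
  is represented by every function that vanishes almost everywhere.\<close>

definition rkhs :: "(real ^ 'n \<Rightarrow> complex) \<Rightarrow> (real ^ 'n \<Rightarrow> complex) set" where
  "rkhs \<rho> = {g. square_integrable g \<and> rkhs_norm_sq \<rho> g < \<infinity>}"

definition rkhs_norm :: "(real ^ 'n \<Rightarrow> complex) \<Rightarrow> (real ^ 'n \<Rightarrow> complex) \<Rightarrow> real" where
  "rkhs_norm \<rho> g = sqrt (enn2real (rkhs_norm_sq \<rho> g))"

definition C_switch :: "(real ^ 'n \<Rightarrow> complex) \<Rightarrow> (real ^ 'n \<Rightarrow> complex) \<Rightarrow> ennreal" where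
  "C_switch \<rho>_pivot \<rho>_mod =
     (if rkhs \<rho>_pivot \<subseteq> rkhs \<rho>_mod
      then SUP \<eta> \<in> {\<eta> \<in> rkhs \<rho>_pivot. \<not> (AE z in lborel. \<eta> z = 0)}.
             ennreal (rkhs_norm \<rho>_mod \<eta> / rkhs_norm \<rho>_pivot \<eta>)
      else \<infinity>)"

definition rkhs_continuously_embeds ::
    "(real ^ 'n \<Rightarrow> complex) \<Rightarrow> (real ^ 'n \<Rightarrow> complex) \<Rightarrow> bool" where
  "rkhs_continuously_embeds \<rho>\<^sub>1 \<rho>\<^sub>2 \<longleftrightarrow>
     rkhs \<rho>\<^sub>1 \<subseteq> rkhs \<rho>\<^sub>2 \<and>
     (\<exists>C::real. \<forall>g \<in> rkhs \<rho>\<^sub>1. rkhs_norm \<rho>\<^sub>2 g \<le> C * rkhs_norm \<rho>\<^sub>1 g)"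

lemma translation_invariant_kernel_psd:
  fixes \<rho> :: "real ^ 'n \<Rightarrow> complex" and c :: "real ^ 'n \<Rightarrow> complex"
  assumes \<rho>: "translation_invariant_kernel \<rho>" and S: "finite S"
  defines "q \<equiv> \<Sum>s\<in>S. \<Sum>t\<in>S. c s * cnj (c t) * \<rho> (s - t)"
  shows "Im q = 0 \<and> 0 \<le> Re q"
proof -
  define \<phi> where "\<phi> = fourier \<rho>"
  define E where "E = (\<lambda>\<omega>. \<Sum>s\<in>S. c s * exp (\<i> * of_real (\<omega> \<bullet> s)))"
  have \<phi>: "integrable lborel \<phi>"
    and inv: "\<And>u. \<rho> u = inverse_fourier_integral \<phi> u"
    and nn: "AE \<omega> in lborel. Im (\<phi> \<omega>) = 0 \<and> 0 \<le> Re (\<phi> \<omega>)"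
    using \<rho> by (auto simp: translation_invariant_kernel_def \<phi>_def)
  have int: "integrable lborel (\<lambda>\<omega>. exp (\<i> * of_real (\<omega> \<bullet> u)) * \<phi> \<omega>)" for u :: "real ^ 'n"
    by (rule Bochner_Integration.integrable_bound[OF \<phi>])
      (use \<phi> in \<open>auto simp: norm_mult intro!: borel_measurable_times borel_measurable_integrable
         borel_measurable_continuous_onI continuous_intros\<close>)
  have *: "exp (\<i> * of_real (\<omega> \<bullet> (s - t)))
      = exp (\<i> * of_real (\<omega> \<bullet> s)) * cnj (exp (\<i> * of_real (\<omega> \<bullet> t)))" for \<omega> s t :: "real ^ 'n"
    by (simp add: exp_cnj inner_diff_right algebra_simps flip: exp_add)
  have EE: "E \<omega> * cnj (E \<omega>) * \<phi> \<omega>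
      = (\<Sum>s\<in>S. \<Sum>t\<in>S. c s * cnj (c t) * (exp (\<i> * of_real (\<omega> \<bullet> (s - t))) * \<phi> \<omega>))" for \<omega>
    unfolding E_def * cnj_sum sum_product sum_distrib_right by (simp add: sum_distrib_left mult_ac)
  have "integrable lborel (\<lambda>\<omega>. E \<omega> * cnj (E \<omega>) * \<phi> \<omega>)"
    unfolding EE by (intro Bochner_Integration.integrable_sum integrable_mult_right int)
  note I = integral_Im[OF this, symmetric] and R = integral_Re[OF this, symmetric]
  have sq: "E \<omega> * cnj (E \<omega>) = of_real ((cmod (E \<omega>))\<^sup>2)" for \<omega>
    by (rule complex_norm_square[symmetric])
  have "Im (LINT \<omega>|lborel. E \<omega> * cnj (E \<omega>) * \<phi> \<omega>) = 0"
    unfolding I unfolding sq by (rule integral_eq_zero_AE) (use nn in \<open>auto simp del: of_real_power\<close>)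
  moreover have "0 \<le> Re (LINT \<omega>|lborel. E \<omega> * cnj (E \<omega>) * \<phi> \<omega>)"
    unfolding R unfolding sq by (rule integral_nonneg_AE) (use nn in \<open>auto simp del: of_real_power\<close>)
  moreover have "(LINT \<omega>|lborel. E \<omega> * cnj (E \<omega>) * \<phi> \<omega>)
      = (\<Sum>s\<in>S. \<Sum>t\<in>S. c s * cnj (c t) * (LINT \<omega>|lborel. exp (\<i> * of_real (\<omega> \<bullet> (s - t))) * \<phi> \<omega>))"
    unfolding EE
    by (subst Bochner_Integration.integral_sum Bochner_Integration.integral_mult_right
        | intro Bochner_Integration.integrable_sum integrable_mult_right int sum.cong refl)+
  then have "q = of_real (1 / (2 * pi) ^ CARD('n)) * (LINT \<omega>|lborel. E \<omega> * cnj (E \<omega>) * \<phi> \<omega>)"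
    unfolding q_def inv inverse_fourier_integral_def
    by (simp only: sum_distrib_left mult_ac)
  ultimately show ?thesis
    by (simp only: Re_complex_of_real Im_complex_of_real times_complex.sel) simp
qed


section \<open>The sinc-4 kernel\<close>

text \<open>\<^term>\<open>sinc\<close> is the continuous extension of \<open>sin x / x\<close>, with value 1 at 0.\<close>

definition sinc4 :: "real \<Rightarrow> real ^ 'n \<Rightarrow> complex" where
  "sinc4 \<tau> u = of_real (\<Prod>i\<in>UNIV. sinc (u $ i / (4 * \<tau>)) ^ 4)"

definition low_freq :: "real \<Rightarrow> (real ^ 'n) set" where
  "low_freq \<tau> = {\<omega>. \<forall>i. - (1 / \<tau>) \<le> \<omega> $ i \<and> \<omega> $ i \<le> 1 / \<tau>}"


section \<open>Essential suprema and infima\<close>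

text \<open>Dual to \<^const>\<open>esssup\<close>.\<close>

definition essinf :: "'a measure \<Rightarrow>
    ('a \<Rightarrow> 'b::{second_countable_topology, dense_linorder, linorder_topology, complete_linorder}) \<Rightarrow> 'b" where
  "essinf M f = (if f \<in> borel_measurable M then Liminf (ae_filter M) f else bot)"

abbreviation esssup_on :: "(real ^ 'n) set \<Rightarrow> (real ^ 'n \<Rightarrow> ennreal) \<Rightarrow> ennreal" where
  "esssup_on A \<equiv> esssup (restrict_space lborel A)"

abbreviation essinf_on :: "(real ^ 'n) set \<Rightarrow> (real ^ 'n \<Rightarrow> ennreal) \<Rightarrow> ennreal" where
  "essinf_on A \<equiv> essinf (restrict_space lborel A)"

end

theory Submission
  imports Defs "HOL-Probability.Characteristic_Functions"
begin

text \<open>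
  Write \<open>\<phi>\<close> for the transform of \<open>\<Psi> = sinc4 \<tau>\<close>, \<open>m\<close> for that of \<open>\<rho>_mod\<close>, and \<open>K\<close> for the essential
  supremum of \<open>sqrt (\<phi> / m)\<close> over the low frequencies.  Both RKHS norms are weighted \<open>L\<^sup>2\<close> norms of the
  transform, with weights \<open>1 / \<phi>\<close> and \<open>1 / m\<close>, so on the spectral side the switch is the identity between two
  weighted spaces, and the square of its norm is the essential supremum of the quotient of the weights.

  \<^bold>\<open>Spectrum.\<close>  That \<open>\<phi>\<close> is nonnegative and vanishes off the low frequencies (\<open>spectrum_sinc4\<close>) holds
  because each factor sinc averages the transform over a cube.

  \<^bold>\<open>Upper bound.\<close>  If \<open>g\<close> has finite pivot norm, its transform vanishes almost everywhere where \<open>\<phi>\<close> does,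
  and elsewhere \<open>1 / m \<le> K\<^sup>2 / \<phi>\<close> (\<open>rkhs_norm_sq_le\<close>).  The first step needs the \<open>L\<^sup>2\<close> transform
  of \<open>g\<close> to be measurable, hence to exist.  It exists by completeness of \<open>L\<^sup>2\<close> and Bessel's
  inequality (\<open>L2_fourier_exists\<close>).

  \<^bold>\<open>Lower bound.\<close>  The density \<open>m\<close> is merely measurable, so the natural extremal functions, with
  transforms concentrated on the set where \<open>\<phi> / m\<close> is almost maximal, would call for inversion of the
  \<open>L\<^sup>2\<close> transform.  Linear combinations of translates of \<open>\<Psi>\<close> suffice instead: their transforms are \<open>\<phi>\<close> times
  trigonometric polynomials, which are uniformly dense on the compact set of low frequencies by
  Stone-Weierstrass.  Testing against them yields \<open>\<phi>\<^sup>2 / m \<le> c\<^sup>2 * \<phi>\<close> almost everywhere if \<open>c\<close> is the norm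
  of the switch (\<open>spectral_ratio_le_C_switch\<close>).

  The remaining claims are pointwise estimates of \<open>\<phi> / m\<close>, as \<open>\<phi>\<close> is bounded by the \<open>L\<^sup>1\<close> norm of
  \<open>\<Psi>\<close>.
\<close>


section \<open>The Fourier integral on Euclidean space\<close>

text \<open>The basis vectors of \<open>real ^ 'n\<close> are the \<open>axis i 1\<close>, so the claim is Fubini for \<^const>\<open>lborel\<close> as a product over \<^const>\<open>Basis\<close>, reindexed by
  \<open>i\<close>.\<close>

lemma lborel_vec_prod:
  fixes f :: "'n::finite \<Rightarrow> real \<Rightarrow> 'a::{real_normed_field,banach,second_countable_topology}"
  assumes f: "\<And>i. integrable lborel (f i)"
  shows lborel_vec_prod_integrable: "integrable lborel (\<lambda>z::real^'n. \<Prod>i\<in>UNIV. f i (z $ i))"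
    and lborel_vec_prod_integral:
      "(LINT z::real^'n|lborel. (\<Prod>i\<in>UNIV. f i (z $ i))) = (\<Prod>i\<in>UNIV. LINT x|lborel. f i x)"
proof -
  interpret P: product_sigma_finite "\<lambda>_::real^'n. lborel :: real measure" ..
  have inj: "inj (\<lambda>i::'n. axis i (1::real))"
    by (auto simp: inj_on_def axis_eq_axis)
  have B: "Basis = range (\<lambda>i::'n. axis i (1::real))"
    by (auto simp: Basis_vec_def)
  define ix where "ix = inv (\<lambda>i::'n. axis i (1::real))"
  have ix: "ix (axis i 1) = i" for i
    unfolding ix_def using inj by (rule inv_f_f)
  have reindex: "(\<Prod>b\<in>Basis. F b) = (\<Prod>i\<in>UNIV. F (axis i 1))" for F :: "real^'n \<Rightarrow> 'a"
    unfolding B by (subst prod.reindex[OF inj]) simp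
  have coord: "(\<Sum>b\<in>Basis. x b *\<^sub>R b) $ i = x (axis i 1)" for x :: "real^'n \<Rightarrow> real" and i
  proof -
    have "(\<Sum>b\<in>Basis. x b *\<^sub>R b) \<bullet> axis i 1 = x (axis i 1)"
      by (rule inner_sum_left_Basis) (auto simp: B)
    then show ?thesis by (simp add: inner_axis)
  qed
  have m[measurable]: "(\<lambda>z::real^'n. \<Prod>i\<in>UNIV. f i (z $ i)) \<in> borel_measurable borel"
    using borel_measurable_integrable[OF f] by measurable
  have T: "(\<lambda>x. \<Sum>b\<in>Basis. x b *\<^sub>R b) \<in> measurable (\<Pi>\<^sub>M b\<in>(Basis::(real^'n) set). lborel) borel"
    by measurable
  have eq: "(\<Prod>i\<in>UNIV. f i ((\<Sum>b\<in>Basis. x b *\<^sub>R b) $ i)) = (\<Prod>b\<in>Basis. f (ix b) (x b))" for x :: "real^'n \<Rightarrow> real"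
    by (simp only: reindex ix coord)
  have int: "integrable (\<Pi>\<^sub>M b\<in>Basis. lborel) (\<lambda>x::real^'n\<Rightarrow>real. \<Prod>b\<in>Basis. f (ix b) (x b))"
    by (rule P.product_integrable_prod) (auto simp: f)
  show "integrable lborel (\<lambda>z::real^'n. \<Prod>i\<in>UNIV. f i (z $ i))"
    by (subst lborel_eq, subst integrable_distr_eq[OF T]) (simp_all add: eq int del: sum_component)
  have "(LINT z::real^'n|lborel. (\<Prod>i\<in>UNIV. f i (z $ i)))
      = (LINT x|(\<Pi>\<^sub>M b\<in>Basis. lborel). (\<Prod>b\<in>Basis. f (ix b) (x b)))"
    by (subst lborel_eq, subst integral_distr[OF T]) (simp_all add: eq del: sum_component)
  also have "\<dots> = (\<Prod>b\<in>Basis. LINT x|lborel. f (ix b) x)"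
    by (rule P.product_integral_prod) (auto simp: f)
  finally show "(LINT z::real^'n|lborel. (\<Prod>i\<in>UNIV. f i (z $ i))) = (\<Prod>i\<in>UNIV. LINT x|lborel. f i x)"
    by (simp add: reindex ix)
qed

lemma continuous_imp_borel_lborel:
  "continuous_on UNIV f \<Longrightarrow> f \<in> borel_measurable lborel"
  by (simp add: borel_measurable_continuous_onI)

lemma integrable_mult_bounded:
  fixes g k :: "'a \<Rightarrow> complex"
  assumes "integrable M g" "k \<in> borel_measurable M" "\<And>x. cmod (k x) \<le> B"
  shows "integrable M (\<lambda>x. g x * k x)"
proof (rule Bochner_Integration.integrable_bound)
  show "integrable M (\<lambda>x. B * cmod (g x))" using assms by auto
  show "AE x in M. norm (g x * k x) \<le> norm (B * cmod (g x))"
  proof (rule AE_I2)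
    fix x
    have "cmod (g x) * cmod (k x) \<le> cmod (g x) * \<bar>B\<bar>" 
      by (intro mult_left_mono order_trans[OF assms(3)]) auto
    then show "norm (g x * k x) \<le> norm (B * cmod (g x))" by (simp add: norm_mult abs_mult mult.commute)
  qed
qed (use assms in auto)

lemma integrable_character:
  fixes g :: "real^'n \<Rightarrow> complex"
  assumes "integrable lborel g"
  shows "integrable lborel (\<lambda>z. g z * exp (- \<i> * of_real (\<omega> \<bullet> z)))"
  by (rule integrable_mult_bounded[OF assms, where B=1]) auto

lemma borel_measurable_fourier_integral[measurable]:
  fixes g :: "real^'n \<Rightarrow> complex"
  assumes [measurable]: "g \<in> borel_measurable borel"
  shows "fourier_integral g \<in> borel_measurable borel"
proof -
  have "(\<lambda>(w,z). exp (- (\<i> * of_real (w \<bullet> z)))) \<in> borel_measurable (borel :: ((real^'n) \<times> (real^'n)) measure)"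
    unfolding case_prod_beta by (intro borel_measurable_continuous_onI continuous_intros)
  then have [measurable]: "(\<lambda>(w,z). exp (- (\<i> * of_real (w \<bullet> z)))) \<in> borel_measurable ((borel :: (real^'n) measure) \<Otimes>\<^sub>M lborel)"
    by (subst measurable_cong_sets[OF sets_pair_measure_cong[OF refl sets_lborel] refl]) (simp add: borel_prod)
  show ?thesis
    unfolding fourier_integral_def[abs_def]
    by (rule lborel.borel_measurable_lebesgue_integral) (simp add: case_prod_beta)
qed

lemma cmod_fourier_integral_le:
  fixes g :: "real^'n \<Rightarrow> complex"
  shows "cmod (fourier_integral g \<omega>) \<le> (LINT z|lborel. cmod (g z))"
  using integral_norm_bound[of lborel "\<lambda>z. g z * exp (- \<i> * of_real (\<omega> \<bullet> z))"]
  by (simp add: fourier_integral_def norm_mult)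

lemma fourier_integral_linear:
  fixes g k :: "real^'n \<Rightarrow> complex"
  assumes "integrable lborel g" "integrable lborel k"
  shows "fourier_integral (\<lambda>z. a * g z + b * k z) \<omega> = a * fourier_integral g \<omega> + b * fourier_integral k \<omega>"
  using integrable_character[OF assms(1), of \<omega>] integrable_character[OF assms(2), of \<omega>]
  by (simp add: fourier_integral_def algebra_simps)

text \<open>The multiplication formula: by Fubini the transform can be moved from
  one factor to the other.  Every interchange of integrals below that involves phases is an instance
  of it; taking a modulated function for \<open>k\<close> turns it into a convolution theorem.\<close>

lemma fourier_integral_mult_formula:
  fixes g k :: "real^'n \<Rightarrow> complex"
  assumes g: "integrable lborel g" and k: "integrable lborel k"
  shows "(LINT \<omega>|lborel. fourier_integral g \<omega> * k \<omega>) = (LINT z|lborel. g z * fourier_integral k z)"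
proof -
  have [measurable]: "g \<in> borel_measurable borel" "k \<in> borel_measurable borel"
    using g k by (auto dest: borel_measurable_integrable)
  have [measurable]: "(\<lambda>x. exp (- (\<i> * of_real (fst x \<bullet> snd x)))) \<in> borel_measurable (borel \<Otimes>\<^sub>M (borel :: (real^'n) measure))"
    unfolding borel_prod by (intro borel_measurable_continuous_onI continuous_intros)
  have int: "integrable (lborel \<Otimes>\<^sub>M lborel) (\<lambda>(z, \<omega>). g z * k \<omega> * exp (- \<i> * of_real (z \<bullet> \<omega>)))"
  proof (rule lborel_pair.Fubini_integrable)
    show "(\<lambda>(z, \<omega>). g z * k \<omega> * exp (- \<i> * of_real (z \<bullet> \<omega>))) \<in> borel_measurable (lborel \<Otimes>\<^sub>M (lborel :: (real^'n) measure))"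
      by (simp add: case_prod_beta)
    show "integrable lborel (\<lambda>z. LINT \<omega>|lborel. norm (case (z, \<omega>) of (z, \<omega>) \<Rightarrow> g z * k \<omega> * exp (- \<i> * of_real (z \<bullet> \<omega>))))"
      using g k by (simp add: norm_mult)
    show "AE z in lborel. integrable lborel (\<lambda>\<omega>. case (z, \<omega>) of (z, \<omega>) \<Rightarrow> g z * k \<omega> * exp (- \<i> * of_real (z \<bullet> \<omega>)))"
      using integrable_character[OF k] by (simp add: mult.assoc)
  qed
  have "(LINT \<omega>|lborel. fourier_integral g \<omega> * k \<omega>) 
      = (LINT \<omega>|lborel. LINT z|lborel. g z * k \<omega> * exp (- \<i> * of_real (z \<bullet> \<omega>)))"
    unfolding fourier_integral_def
    by (intro Bochner_Integration.integral_cong refl, subst integral_mult_left_zero[symmetric])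
       (simp add: inner_commute mult_ac)
  also have "\<dots> = (LINT z|lborel. LINT \<omega>|lborel. g z * k \<omega> * exp (- \<i> * of_real (z \<bullet> \<omega>)))"
    using lborel_pair.Fubini_integral[OF int] by simp
  also have "\<dots> = (LINT z|lborel. g z * fourier_integral k z)"
    by (simp add: fourier_integral_def mult.assoc)
  finally show ?thesis .
qed

lemma fourier_integral_prod:
  fixes f :: "'n::finite \<Rightarrow> real \<Rightarrow> complex"
  assumes f: "\<And>i. integrable lborel (f i)"
  shows "fourier_integral (\<lambda>z. \<Prod>i\<in>UNIV. f i (z $ i)) \<omega>
       = (\<Prod>i\<in>UNIV. LINT x|lborel. f i x * exp (- \<i> * of_real (\<omega> $ i * x)))"
proof -
  have int: "integrable lborel (\<lambda>x. f i x * exp (- \<i> * of_real (\<omega> $ i * x)))" for i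
    by (rule integrable_mult_bounded[OF f, where B=1])
       (auto intro!: continuous_imp_borel_lborel continuous_intros)
  have "(\<Prod>i\<in>UNIV. f i (z $ i)) * exp (- \<i> * of_real (\<omega> \<bullet> z))
      = (\<Prod>i\<in>UNIV. f i (z $ i) * exp (- \<i> * of_real (\<omega> $ i * z $ i)))" for z :: "real^'n"
    by (simp add: prod.distrib inner_vec_def exp_sum sum_distrib_left flip: sum_negf)
  then show ?thesis
    unfolding fourier_integral_def using lborel_vec_prod_integral[OF int] by simp
qed


section \<open>Gaussians\<close>

definition gauss :: "real \<Rightarrow> real^'n \<Rightarrow> complex" where
  "gauss s z = of_real (exp (- (s * norm z)\<^sup>2 / 2))"

text \<open>The transform of \<open>gauss s\<close>: up to the factor \<open>(2 * pi) ^ CARD('n)\<close> this is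
  the density of a centred normal distribution with standard deviation \<open>s\<close> in each coordinate,
  so its mass does not depend on \<open>s\<close> and concentrates at the origin as \<open>s\<close> tends to 0.\<close>

definition gauss_spectrum :: "real \<Rightarrow> real^'n \<Rightarrow> real" where
  "gauss_spectrum s \<omega> = (2 * pi) ^ CARD('n) * (\<Prod>i\<in>UNIV. normal_density 0 s (\<omega> $ i))"

text \<open>The characteristic function of the standard normal distribution, rescaled.\<close>

lemma gauss_1d:
  assumes s: "s > 0"
  shows "integrable lborel (\<lambda>x. complex_of_real (exp (- (s * x)\<^sup>2 / 2)))"
    and "(LINT x|lborel. of_real (exp (- (s * x)\<^sup>2 / 2)) * exp (- \<i> * of_real (w * x)))
       = complex_of_real (2 * pi * normal_density 0 s w)"
proof -
  have e: "exp (- (s * x)\<^sup>2 / 2) = (sqrt (2 * pi) / s) * normal_density 0 (1/s) x" for x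
    using s by (simp add: normal_density_def real_sqrt_divide real_sqrt_mult power_mult_distrib field_simps)
  show "integrable lborel (\<lambda>x. complex_of_real (exp (- (s * x)\<^sup>2 / 2)))"
    unfolding e using s by (intro integrable_of_real integrable_mult_right) auto
  have "complex_of_real (exp (- (w/s)\<^sup>2 / 2)) = char std_normal_distribution (- w / s)"
    by (simp add: char_std_normal_distribution)
  also have "\<dots> = (LINT x|lborel. std_normal_density x *\<^sub>R iexp (- w / s * x))"
    unfolding char_def
    by (rule integral_density) (auto intro!: continuous_imp_borel_lborel continuous_intros)
  also have "\<dots> = s * (LINT x|lborel. std_normal_density (s * x) *\<^sub>R iexp (- w / s * (s * x)))"
    using s by (subst lborel_integral_real_affine[where c=s and t=0]) (auto simp: scaleR_conv_of_real)
  also have "(LINT x|lborel. std_normal_density (s * x) *\<^sub>R iexp (- w / s * (s * x)))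
    = (LINT x|lborel. (1 / sqrt (2*pi)) * (of_real (exp (- (s * x)\<^sup>2 / 2)) * exp (- \<i> * of_real (w * x))))"
    using s by (intro Bochner_Integration.integral_cong)
      (auto simp: std_normal_density_def scaleR_conv_of_real mult.assoc)
  finally have "complex_of_real (exp (- (w/s)\<^sup>2 / 2)) = (s / sqrt (2 * pi)) *
      (LINT x|lborel. of_real (exp (- (s * x)\<^sup>2 / 2)) * exp (- \<i> * of_real (w * x)))"
    by simp
  then have "(LINT x|lborel. of_real (exp (- (s * x)\<^sup>2 / 2)) * exp (- \<i> * of_real (w * x)))
    = of_real (sqrt (2 * pi) / s * exp (- (w/s)\<^sup>2 / 2))"
    using s by (simp add: field_simps)
  also have "sqrt (2 * pi) / s * exp (- (w/s)\<^sup>2 / 2) = 2 * pi * normal_density 0 s w"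
    using s by (simp add: normal_density_def real_sqrt_mult power_divide field_simps)
  finally show "(LINT x|lborel. of_real (exp (- (s * x)\<^sup>2 / 2)) * exp (- \<i> * of_real (w * x)))
       = complex_of_real (2 * pi * normal_density 0 s w)" .
qed

lemma gauss_eq_prod: "gauss s z = (\<Prod>i\<in>UNIV. complex_of_real (exp (- (s * z $ i)\<^sup>2 / 2)))"
  unfolding gauss_def of_real_prod[symmetric] exp_sum[OF finite, symmetric]
  by (simp add: power_mult_distrib norm_vec_def L2_set_def real_sqrt_pow2 sum_nonneg sum_distrib_left sum_negf
      flip: sum_divide_distrib)

lemma integrable_gauss: "s > 0 \<Longrightarrow> integrable lborel (gauss s :: real^'n \<Rightarrow> complex)"
  unfolding gauss_eq_prod[abs_def] by (rule lborel_vec_prod_integrable) (rule gauss_1d)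

lemma fourier_integral_gauss:
  "s > 0 \<Longrightarrow> fourier_integral (gauss s) \<omega> = of_real (gauss_spectrum s \<omega>)"
  unfolding gauss_eq_prod[abs_def]
  by (subst fourier_integral_prod, rule gauss_1d, assumption)
     (simp add: gauss_1d(2)[simplified] gauss_spectrum_def prod.distrib)

lemma gauss_spectrum_nonneg: "0 \<le> gauss_spectrum s \<omega>"
  by (simp add: gauss_spectrum_def prod_nonneg)

lemma gauss_spectrum_even: "gauss_spectrum s (x - y) = gauss_spectrum s (y - x)"
  by (simp add: gauss_spectrum_def normal_density_def power2_commute)

lemma borel_measurable_gauss_spectrum[measurable]: "gauss_spectrum s \<in> borel_measurable borel"
  unfolding gauss_spectrum_def[abs_def] by measurable

lemma nn_integral_gauss_spectrum:
  assumes "s > 0"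
  shows "(\<integral>\<^sup>+\<omega>. ennreal (gauss_spectrum s \<omega>) \<partial>(lborel :: (real^'n) measure)) = ennreal ((2*pi) ^ CARD('n))"
proof -
  have i: "integrable lborel (normal_density 0 s)" using assms by auto
  have "has_bochner_integral lborel (gauss_spectrum s :: real^'n \<Rightarrow> real) ((2*pi) ^ CARD('n))"
    unfolding gauss_spectrum_def[abs_def] has_bochner_integral_iff
    using lborel_vec_prod_integrable[where f="\<lambda>_::'n. normal_density 0 s", OF i] 
      lborel_vec_prod_integral[where f="\<lambda>_::'n. normal_density 0 s", OF i] assms
    by (auto intro!: integrable_mult_right)
  then show ?thesis
    by (subst nn_integral_eq_integral) (auto simp: has_bochner_integral_iff gauss_spectrum_nonneg)
qed

lemma gauss_spectrum_le:
  fixes \<omega> :: "real^'n"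
  assumes s: "s > 0" and d: "0 \<le> d" "d \<le> norm \<omega>"
  shows "gauss_spectrum s \<omega> \<le> (sqrt (2 * pi) / s) ^ CARD('n) * exp (- (d / s)\<^sup>2 / 2)"
proof -
  have e: "2 * pi * normal_density 0 s x = (sqrt (2 * pi) / s) * exp (- (x/s)\<^sup>2 / 2)" for x
    using s by (simp add: normal_density_def real_sqrt_mult power_divide field_simps)
  have "gauss_spectrum s \<omega> = (\<Prod>i\<in>UNIV. 2 * pi * normal_density 0 s (\<omega> $ i))"
    by (simp add: gauss_spectrum_def prod.distrib)
  also have "\<dots> = (sqrt (2 * pi) / s) ^ CARD('n) * (\<Prod>i\<in>UNIV. exp (- (\<omega> $ i / s)\<^sup>2 / 2))"
    unfolding e by (simp only: prod.distrib prod_constant)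
  also have "(\<Prod>i\<in>UNIV. exp (- (\<omega> $ i / s)\<^sup>2 / 2)) = exp (- (norm \<omega> / s)\<^sup>2 / 2)"
    unfolding exp_sum[OF finite, symmetric]
    by (simp add: power_divide norm_vec_def L2_set_def real_sqrt_pow2 sum_nonneg sum_negf flip: sum_divide_distrib)
  also have "exp (- (norm \<omega> / s)\<^sup>2 / 2) \<le> exp (- (d / s)\<^sup>2 / 2)"
    using s d by (simp add: divide_right_mono power_mono)
  finally show ?thesis using s by (simp add: mult_left_mono)
qed

text \<open>The bound of \<open>gauss_spectrum_le\<close> along \<open>s = 1 / Suc n\<close>: the
  exponential beats the power \<open>s ^ - k\<close>.\<close>

lemma gauss_spectrum_bound_tendsto_0:
  assumes "d > 0"
  shows "(\<lambda>n. (sqrt (2 * pi) / (1 / real (Suc n))) ^ k * exp (- (d / (1 / real (Suc n)))\<^sup>2 / 2)) \<longlonglongrightarrow> 0"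
proof -
  define x where "x n = d\<^sup>2 / 2 * (real (Suc n))\<^sup>2" for n
  have "filterlim x at_top sequentially"
    unfolding x_def using assms
    by (intro filterlim_tendsto_pos_mult_at_top[OF tendsto_const] filterlim_pow_at_top
        filterlim_compose[OF filterlim_real_sequentially filterlim_Suc]) auto
  from filterlim_compose[OF tendsto_power_div_exp_0 this]
  have lim: "(\<lambda>n. (sqrt (2 * pi) * (2 / d\<^sup>2)) ^ k * (x n ^ k / exp (x n))) \<longlonglongrightarrow> 0"
    by (rule tendsto_mult_right_zero)
  show ?thesis
  proof (rule Lim_null_comparison[OF always_eventually[OF allI] lim])
    fix n
    have "real (Suc n) ^ k \<le> ((real (Suc n))\<^sup>2) ^ k"
      by (intro power_mono) (auto simp: power2_eq_square)
    also have "\<dots> = (2 / d\<^sup>2 * x n) ^ k" using assms by (simp add: x_def)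
    finally have le: "real (Suc n) ^ k \<le> (2 / d\<^sup>2 * x n) ^ k" .
    have "norm ((sqrt (2 * pi) / (1 / real (Suc n))) ^ k * exp (- (d / (1 / real (Suc n)))\<^sup>2 / 2))
        = (sqrt (2 * pi)) ^ k * real (Suc n) ^ k * exp (- x n)"
      by (simp add: x_def power_mult_distrib)
    also have "\<dots> \<le> (sqrt (2 * pi)) ^ k * (2 / d\<^sup>2 * x n) ^ k * exp (- x n)"
      using le by (intro mult_right_mono mult_left_mono) auto
    also have "\<dots> = (sqrt (2 * pi) * (2 / d\<^sup>2)) ^ k * (x n ^ k / exp (x n))"
      by (simp only: power_mult_distrib exp_minus divide_inverse mult_ac)
    finally show "norm ((sqrt (2 * pi) / (1 / real (Suc n))) ^ k * exp (- (d / (1 / real (Suc n)))\<^sup>2 / 2))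
        \<le> (sqrt (2 * pi) * (2 / d\<^sup>2)) ^ k * (x n ^ k / exp (x n))" .
  qed
qed


section \<open>Bessel's inequality\<close>

lemma nn_integral_translate:
  fixes f :: "real^'n \<Rightarrow> ennreal"
  assumes [measurable]: "f \<in> borel_measurable borel"
  shows "(\<integral>\<^sup>+z. f (z + c) \<partial>lborel) = (\<integral>\<^sup>+z. f z \<partial>lborel)"
proof -
  have "(\<integral>\<^sup>+z. f z \<partial>lborel) = (\<integral>\<^sup>+z. f z \<partial>distr lborel borel ((+) c))"
    by (simp only: lborel_distr_plus)
  also have "\<dots> = (\<integral>\<^sup>+z. f (c + z) \<partial>lborel)"
    by (rule nn_integral_distr) auto
  finally show ?thesis by (simp add: add.commute)
qed

lemma fourier_integral_modulate:
  "fourier_integral (\<lambda>z. exp (\<i> * of_real (\<xi> \<bullet> z)) * g z) \<omega> = fourier_integral g (\<omega> - \<xi>)"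
proof -
  have "exp (\<i> * of_real (\<xi> \<bullet> z)) * g z * exp (- \<i> * of_real (\<omega> \<bullet> z)) 
      = g z * exp (- \<i> * of_real ((\<omega> - \<xi>) \<bullet> z))" for z
    by (simp add: inner_diff_left algebra_simps flip: exp_add)
  then show ?thesis by (simp only: fourier_integral_def)
qed

text \<open>Damping by a Gaussian makes \<open>\<bar>F g\<bar>\<^sup>2\<close> integrable.  Two applications of the
  multiplication formula turn its integral into \<open>\<integral>\<integral> g x * cnj (g y) * H (y - x)\<close> with the nonnegative
  kernel \<open>H = gauss_spectrum s\<close>; as \<open>H\<close> has mass \<open>(2 * pi) ^ CARD('n)\<close>, the bound
  \<open>\<bar>g x * g y\<bar> \<le> \<bar>g x\<bar>\<^sup>2 / 2 + \<bar>g y\<bar>\<^sup>2 / 2\<close> gives the estimate uniformly in \<open>s\<close>.\<close>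

lemma fourier_integral_bessel_gauss:
  fixes g :: "real^'n \<Rightarrow> complex"
  assumes g: "integrable lborel g" and s: "s > 0"
  shows "(\<integral>\<^sup>+\<omega>. ennreal ((cmod (fourier_integral g \<omega>))\<^sup>2 * exp (- (s * norm \<omega>)\<^sup>2 / 2)) \<partial>lborel)
     \<le> ennreal ((2*pi)^CARD('n)) * (\<integral>\<^sup>+z. ennreal ((cmod (g z))\<^sup>2) \<partial>lborel)"
proof -
  have [measurable]: "g \<in> borel_measurable borel"
    using g by (auto dest: borel_measurable_integrable)
  have [measurable]: "gauss s \<in> borel_measurable (borel :: (real^'n) measure)"
    using integrable_gauss[OF s] by (auto dest: borel_measurable_integrable)
  define H :: "real^'n \<Rightarrow> real" where "H = gauss_spectrum s"
  have [measurable]: "H \<in> borel_measurable borel" by (simp add: H_def)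
  define k where "k \<omega> = cnj (fourier_integral g \<omega>) * gauss s \<omega>" for \<omega>
  define A where "A = (LINT z|lborel. cmod (g z))"
  have [measurable]: "(\<lambda>\<omega>. cnj (fourier_integral g \<omega>)) \<in> borel_measurable borel"
    by (rule measurable_compose[OF borel_measurable_fourier_integral])
       (auto intro!: borel_measurable_continuous_onI continuous_intros)
  have k: "integrable lborel k"
    unfolding k_def mult.commute[of "cnj _"]
    by (rule integrable_mult_bounded[OF integrable_gauss[OF s], where B=A])
       (auto simp: A_def cmod_fourier_integral_le)
  have Fk: "cnj (fourier_integral k x) = (LINT y|lborel. g y * of_real (H (y - x)))" for x
  proof -
    have "cnj (fourier_integral k x) = (LINT \<omega>|lborel. cnj (k \<omega> * exp (- \<i> * of_real (x \<bullet> \<omega>))))"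
      unfolding fourier_integral_def by (rule Bochner_Integration.integral_cnj[symmetric])
    also have "\<dots> = (LINT \<omega>|lborel. fourier_integral g \<omega> * (exp (\<i> * of_real (x \<bullet> \<omega>)) * gauss s \<omega>))"
      by (simp add: k_def exp_cnj gauss_def mult_ac)
    also have "\<dots> = (LINT y|lborel. g y * fourier_integral (\<lambda>\<omega>. exp (\<i> * of_real (x \<bullet> \<omega>)) * gauss s \<omega>) y)"
    proof (rule fourier_integral_mult_formula[OF g])
      show "integrable lborel (\<lambda>\<omega>. exp (\<i> * of_real (x \<bullet> \<omega>)) * gauss s \<omega>)"
        unfolding mult.commute[of "exp _"]
        by (rule integrable_mult_bounded[OF integrable_gauss[OF s], where B=1])
           (auto intro!: continuous_imp_borel_lborel continuous_intros)
    qed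
    finally show ?thesis
      by (simp add: fourier_integral_modulate fourier_integral_gauss[OF s] H_def)
  qed
  have sq: "fourier_integral g \<omega> * k \<omega> = of_real ((cmod (fourier_integral g \<omega>))\<^sup>2 * exp (- (s * norm \<omega>)\<^sup>2 / 2))" for \<omega>
    by (simp add: k_def gauss_def complex_norm_square del: of_real_power)
  have int: "integrable lborel (\<lambda>\<omega>. fourier_integral g \<omega> * k \<omega>)"
    unfolding mult.commute[of _ "k _"]
    by (rule integrable_mult_bounded[OF k, where B=A]) (auto simp: A_def cmod_fourier_integral_le)
  have intR: "integrable lborel (\<lambda>\<omega>. (cmod (fourier_integral g \<omega>))\<^sup>2 * exp (- (s * norm \<omega>)\<^sup>2 / 2))"
    using int unfolding sq by (simp only: complex_of_real_integrable_eq)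
  have "(\<integral>\<^sup>+\<omega>. ennreal ((cmod (fourier_integral g \<omega>))\<^sup>2 * exp (- (s * norm \<omega>)\<^sup>2 / 2)) \<partial>lborel)
      = ennreal (LINT \<omega>|lborel. (cmod (fourier_integral g \<omega>))\<^sup>2 * exp (- (s * norm \<omega>)\<^sup>2 / 2))"
    by (rule nn_integral_eq_integral[OF intR]) auto
  also have "(LINT \<omega>|lborel. (cmod (fourier_integral g \<omega>))\<^sup>2 * exp (- (s * norm \<omega>)\<^sup>2 / 2))
      \<le> cmod (LINT \<omega>|lborel. fourier_integral g \<omega> * k \<omega>)"
    unfolding sq by (simp del: of_real_mult of_real_power)
  also have "(LINT \<omega>|lborel. fourier_integral g \<omega> * k \<omega>) = (LINT x|lborel. g x * fourier_integral k x)"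
    by (rule fourier_integral_mult_formula[OF g k])
  also have "ennreal (cmod \<dots>) \<le> (\<integral>\<^sup>+x. ennreal (cmod (g x * fourier_integral k x)) \<partial>lborel)"
    by (rule integral_norm_bound_ennreal, rule integrable_mult_bounded[OF g])
       (use k in \<open>auto intro: cmod_fourier_integral_le borel_measurable_fourier_integral dest: borel_measurable_integrable\<close>)
  also have "\<dots> \<le> (\<integral>\<^sup>+x. ennreal (cmod (g x)) * (\<integral>\<^sup>+y. ennreal (cmod (g y) * H (y - x)) \<partial>lborel) \<partial>lborel)"
  proof (intro nn_integral_mono)
    fix x
    have "integrable lborel (\<lambda>y. g y * of_real (H (y - x)))"
    proof (rule integrable_mult_bounded[OF g, where B="LINT z|lborel. cmod (gauss s z :: complex)"])
      show "cmod (of_real (H (y - x))) \<le> (LINT z|(lborel :: (real^'n) measure). cmod (gauss s z :: complex))" for y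
        unfolding H_def fourier_integral_gauss[OF s, symmetric] by (rule cmod_fourier_integral_le)
    qed simp
    then have "ennreal (cmod (fourier_integral k x)) \<le> (\<integral>\<^sup>+y. ennreal (cmod (g y * of_real (H (y - x)))) \<partial>lborel)"
      by (subst complex_mod_cnj[symmetric], subst Fk) (rule integral_norm_bound_ennreal)
    also have "\<dots> = (\<integral>\<^sup>+y. ennreal (cmod (g y) * H (y - x)) \<partial>lborel)"
      by (simp add: norm_mult H_def gauss_spectrum_nonneg)
    finally show "ennreal (cmod (g x * fourier_integral k x)) 
        \<le> ennreal (cmod (g x)) * (\<integral>\<^sup>+y. ennreal (cmod (g y) * H (y - x)) \<partial>lborel)"
      by (simp add: norm_mult ennreal_mult' mult_left_mono)
  qed
  also have "\<dots> = (\<integral>\<^sup>+x. \<integral>\<^sup>+y. ennreal (cmod (g x) * (cmod (g y) * H (y - x))) \<partial>lborel \<partial>lborel)"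
    by (simp add: nn_integral_cmult ennreal_mult')
  also have "\<dots> \<le> (\<integral>\<^sup>+x. \<integral>\<^sup>+y. ennreal ((cmod (g x))\<^sup>2 / 2) * ennreal (H (y - x))
                               + ennreal ((cmod (g y))\<^sup>2 / 2) * ennreal (H (y - x)) \<partial>lborel \<partial>lborel)"
  proof (intro nn_integral_mono)
    fix x y
    have "cmod (g x) * cmod (g y) \<le> (cmod (g x))\<^sup>2 / 2 + (cmod (g y))\<^sup>2 / 2"
      using sum_squares_bound[of "cmod (g x)" "cmod (g y)"] by simp
    then have "cmod (g x) * cmod (g y) * H (y - x) \<le> ((cmod (g x))\<^sup>2 / 2 + (cmod (g y))\<^sup>2 / 2) * H (y - x)"
      by (rule mult_right_mono) (simp add: H_def gauss_spectrum_nonneg)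
    then show "ennreal (cmod (g x) * (cmod (g y) * H (y - x))) \<le> ennreal ((cmod (g x))\<^sup>2 / 2) * ennreal (H (y - x))
                               + ennreal ((cmod (g y))\<^sup>2 / 2) * ennreal (H (y - x))"
      by (simp add: H_def gauss_spectrum_nonneg distrib_right mult.assoc
          flip: ennreal_plus ennreal_mult)
  qed
  also have "\<dots> = (\<integral>\<^sup>+x. \<integral>\<^sup>+y. ennreal ((cmod (g x))\<^sup>2 / 2) * ennreal (H (y - x)) \<partial>lborel \<partial>lborel)
                + (\<integral>\<^sup>+x. \<integral>\<^sup>+y. ennreal ((cmod (g y))\<^sup>2 / 2) * ennreal (H (y - x)) \<partial>lborel \<partial>lborel)"
    by (subst nn_integral_add[symmetric]) (auto simp: nn_integral_add)
  also have "(\<integral>\<^sup>+x. \<integral>\<^sup>+y. ennreal ((cmod (g x))\<^sup>2 / 2) * ennreal (H (y - x)) \<partial>lborel \<partial>lborel)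
      = ennreal ((2*pi)^CARD('n)) * (\<integral>\<^sup>+z. ennreal ((cmod (g z))\<^sup>2 / 2) \<partial>lborel)"
  proof -
    have "(\<integral>\<^sup>+y. ennreal (H (y - x)) \<partial>lborel) = ennreal ((2*pi)^CARD('n))" for x
      using nn_integral_translate[of "\<lambda>y. ennreal (H y)" "- x"] nn_integral_gauss_spectrum[OF s, where 'n='n]
      by (simp add: H_def)
    then show ?thesis by (simp add: nn_integral_cmult nn_integral_multc mult.commute)
  qed
  also have "(\<integral>\<^sup>+x. \<integral>\<^sup>+y. ennreal ((cmod (g y))\<^sup>2 / 2) * ennreal (H (y - x)) \<partial>lborel \<partial>lborel)
      = (\<integral>\<^sup>+y. \<integral>\<^sup>+x. ennreal ((cmod (g y))\<^sup>2 / 2) * ennreal (H (y - x)) \<partial>lborel \<partial>lborel)"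
    by (rule lborel_pair.Fubini') (simp add: case_prod_beta)
  also have "\<dots> = ennreal ((2*pi)^CARD('n)) * (\<integral>\<^sup>+z. ennreal ((cmod (g z))\<^sup>2 / 2) \<partial>lborel)"
  proof -
    have "(\<integral>\<^sup>+x. ennreal (H (y - x)) \<partial>lborel) = ennreal ((2*pi)^CARD('n))" for y
      using nn_integral_translate[of "\<lambda>y. ennreal (H y)" "- y"] nn_integral_gauss_spectrum[OF s, where 'n='n]
      by (simp add: H_def gauss_spectrum_even[of s y])
    then show ?thesis by (simp add: nn_integral_cmult nn_integral_multc mult.commute)
  qed
  also have "ennreal ((2*pi)^CARD('n)) * (\<integral>\<^sup>+z. ennreal ((cmod (g z))\<^sup>2 / 2) \<partial>lborel)
       + ennreal ((2*pi)^CARD('n)) * (\<integral>\<^sup>+z. ennreal ((cmod (g z))\<^sup>2 / 2) \<partial>lborel)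
     = ennreal ((2*pi)^CARD('n)) * (\<integral>\<^sup>+z. ennreal ((cmod (g z))\<^sup>2) \<partial>lborel)"
    unfolding distrib_left[symmetric]
    by (subst nn_integral_add[symmetric]) (auto simp flip: ennreal_plus)
  finally show ?thesis by (simp add: ennreal_leI)
qed

text \<open>One half of Plancherel's theorem, by Fatou from the damped version.\<close>

lemma fourier_integral_bessel:
  fixes g :: "real^'n \<Rightarrow> complex"
  assumes g: "integrable lborel g"
  shows "(\<integral>\<^sup>+\<omega>. ennreal ((cmod (fourier_integral g \<omega>))\<^sup>2) \<partial>lborel)
     \<le> ennreal ((2*pi)^CARD('n)) * (\<integral>\<^sup>+z. ennreal ((cmod (g z))\<^sup>2) \<partial>lborel)"
proof -
  have [measurable]: "g \<in> borel_measurable borel"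
    using g by (auto dest: borel_measurable_integrable)
  define f where "f n \<omega> = ennreal ((cmod (fourier_integral g \<omega>))\<^sup>2 * exp (- (1 / real (Suc n) * norm \<omega>)\<^sup>2 / 2))" for n \<omega>
  have [measurable]: "f n \<in> borel_measurable lborel" for n
    unfolding f_def[abs_def] by measurable
  have lim: "(\<lambda>n. f n \<omega>) \<longlonglongrightarrow> ennreal ((cmod (fourier_integral g \<omega>))\<^sup>2)" for \<omega>
  proof -
    have "(\<lambda>n. (cmod (fourier_integral g \<omega>))\<^sup>2 * exp (- (1 / real (Suc n) * norm \<omega>)\<^sup>2 / 2))
       \<longlonglongrightarrow> (cmod (fourier_integral g \<omega>))\<^sup>2 * exp (- (0 * norm \<omega>)\<^sup>2 / 2)"
      by (intro tendsto_intros LIMSEQ_Suc[OF lim_1_over_n]) auto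
    then show ?thesis unfolding f_def by (intro tendsto_ennrealI) simp
  qed
  have "(\<integral>\<^sup>+\<omega>. ennreal ((cmod (fourier_integral g \<omega>))\<^sup>2) \<partial>lborel) = (\<integral>\<^sup>+\<omega>. liminf (\<lambda>n. f n \<omega>) \<partial>lborel)"
    using lim_imp_Liminf[OF _ lim] by simp
  also have "\<dots> \<le> liminf (\<lambda>n. \<integral>\<^sup>+\<omega>. f n \<omega> \<partial>lborel)"
    by (rule nn_integral_liminf) measurable
  also have "\<dots> \<le> ennreal ((2*pi)^CARD('n)) * (\<integral>\<^sup>+z. ennreal ((cmod (g z))\<^sup>2) \<partial>lborel)"
    by (intro Liminf_le always_eventually allI) 
       (simp_all only: f_def sequentially_bot not_False_eq_True fourier_integral_bessel_gauss[OF g] divide_pos_pos zero_less_one of_nat_0_less_iff zero_less_Suc)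
  finally show ?thesis .
qed


section \<open>The Fourier transform of square-integrable functions\<close>

text \<open>The Riesz-Fischer argument: a rapidly converging subsequence converges almost everywhere, and
  Fatou's lemma transfers the Cauchy estimate to its pointwise limit.\<close>

lemma L2_complete:
  fixes f :: "nat \<Rightarrow> 'a \<Rightarrow> complex"
  assumes [measurable]: "\<And>n. f n \<in> borel_measurable M"
    and Cauchy: "\<And>e. e > 0 \<Longrightarrow> \<exists>N. \<forall>m\<ge>N. \<forall>n\<ge>N. (\<integral>\<^sup>+x. ennreal ((cmod (f m x - f n x))\<^sup>2) \<partial>M) \<le> ennreal e"
  shows "\<exists>h\<in>borel_measurable M. (\<lambda>n. \<integral>\<^sup>+x. ennreal ((cmod (f n x - h x))\<^sup>2) \<partial>M) \<longlonglongrightarrow> 0"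
proof -
  obtain N where N: "\<And>e m n. e > 0 \<Longrightarrow> m \<ge> N e \<Longrightarrow> n \<ge> N e \<Longrightarrow>
      (\<integral>\<^sup>+x. ennreal ((cmod (f m x - f n x))\<^sup>2) \<partial>M) \<le> ennreal e"
    using Cauchy by metis
  \<comment> \<open>The partial sums make \<open>r\<close> monotone, and the summand \<open>k\<close> makes it unbounded.\<close>
  define r where "r k = (\<Sum>j\<le>k. N (1 / 4 ^ j)) + k" for k :: nat
  have rN: "r k \<ge> N (1 / 4 ^ k)" and rk: "r k \<ge> k" for k
    unfolding r_def by (auto intro: trans_le_add1 member_le_sum)
  have rmono: "r k \<le> r (Suc k)" for k
    unfolding r_def by simp
  define d where "d k x = cmod (f (r (Suc k)) x - f (r k) x)" for k x
  have [measurable]: "d k \<in> borel_measurable M" for k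
    unfolding d_def[abs_def] by measurable
  have dint: "(\<integral>\<^sup>+x. ennreal ((d k x)\<^sup>2) \<partial>M) \<le> ennreal (1 / 4 ^ k)" for k
    unfolding d_def using rN[of k] rmono[of k] by (intro N) auto
  have "(\<integral>\<^sup>+x. (\<Sum>k. ennreal (2 ^ k * (d k x)\<^sup>2)) \<partial>M) = (\<Sum>k. \<integral>\<^sup>+x. ennreal (2 ^ k * (d k x)\<^sup>2) \<partial>M)"
    by (rule nn_integral_suminf) measurable
  also have "\<dots> \<le> (\<Sum>k. ennreal ((1/2) ^ k))"
  proof (intro suminf_le summableI)
    fix k
    have "(\<integral>\<^sup>+x. ennreal (2 ^ k * (d k x)\<^sup>2) \<partial>M) = ennreal (2 ^ k) * (\<integral>\<^sup>+x. ennreal ((d k x)\<^sup>2) \<partial>M)"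
      by (subst nn_integral_cmult[symmetric]) (auto simp: ennreal_mult)
    also have "\<dots> \<le> ennreal (2 ^ k) * ennreal (1 / 4 ^ k)"
      using dint by (rule mult_left_mono) simp
    also have "\<dots> = ennreal ((1/2) ^ k)"
      by (subst ennreal_mult[symmetric]) (auto simp: power_divide field_simps simp flip: power_mult_distrib)
    finally show "(\<integral>\<^sup>+x. ennreal (2 ^ k * (d k x)\<^sup>2) \<partial>M) \<le> ennreal ((1/2) ^ k)" .
  qed
  also have "\<dots> < \<infinity>"
    by (subst suminf_ennreal2) (auto intro!: summable_geometric)
  finally have fin: "AE x in M. (\<Sum>k. ennreal (2 ^ k * (d k x)\<^sup>2)) \<noteq> \<infinity>"
    by (intro nn_integral_PInf_AE) auto
  have conv: "AE x in M. convergent (\<lambda>k. f (r k) x)"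
    using fin
  proof eventually_elim
    case (elim x)
    then have s1: "summable (\<lambda>k. 2 ^ k * (d k x)\<^sup>2)"
      by (intro summable_suminf_not_top) (auto simp: top_ennreal_def)
    have "summable (\<lambda>k. d k x)"
    proof (rule summable_comparison_test')
      show "summable (\<lambda>k. (1/2) ^ k + 2 ^ k * (d k x)\<^sup>2)"
        by (intro summable_add s1 summable_geometric) auto
      fix k :: nat
      \<comment> \<open>If \<open>d k x\<close> exceeds \<open>(1/2) ^ k\<close>, then it is at most \<open>2 ^ k * (d k x)\<^sup>2\<close>.\<close>
      show "norm (d k x) \<le> (1/2) ^ k + 2 ^ k * (d k x)\<^sup>2"
      proof (cases "d k x \<le> (1/2)^k")
        case True then show ?thesis by (simp add: d_def add_increasing2)
      next
        case False
        then have "1 \<le> 2 ^ k * d k x" by (simp add: power_divide field_simps)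
        then have "1 * d k x \<le> 2 ^ k * d k x * d k x" by (intro mult_right_mono) (auto simp: d_def)
        then show ?thesis by (simp add: d_def power2_eq_square add_increasing mult.assoc)
      qed
    qed
    then have "summable (\<lambda>k. f (r (Suc k)) x - f (r k) x)"
      unfolding d_def by (rule summable_norm_cancel)
    from tendsto_add[OF summable_LIMSEQ[OF this] tendsto_const[of "f (r 0) x"]]
    show ?case unfolding sum_lessThan_telescope[of "\<lambda>k. f (r k) x"] by (auto simp: convergent_def)
  qed
  define h where "h x = lim (\<lambda>k. f (r k) x)" for x
  have h[measurable]: "h \<in> borel_measurable M"
    unfolding h_def[abs_def] by (rule borel_measurable_lim_metric) measurable
  have lim: "AE x in M. (\<lambda>k. f (r k) x) \<longlonglongrightarrow> h x"
    using conv by eventually_elim (simp add: h_def convergent_LIMSEQ_iff)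
  have bound: "(\<integral>\<^sup>+x. ennreal ((cmod (f n x - h x))\<^sup>2) \<partial>M) \<le> ennreal e" if e: "e > 0" and n: "n \<ge> N e" for n e
  proof -
    have "AE x in M. ennreal ((cmod (f n x - h x))\<^sup>2) = liminf (\<lambda>k. ennreal ((cmod (f n x - f (r k) x))\<^sup>2))"
      using lim
    proof eventually_elim
      case (elim x)
      then have "(\<lambda>k. ennreal ((cmod (f n x - f (r k) x))\<^sup>2)) \<longlonglongrightarrow> ennreal ((cmod (f n x - h x))\<^sup>2)"
        by (intro tendsto_ennrealI tendsto_intros)
      from lim_imp_Liminf[OF _ this] show ?case by simp
    qed
    then have "(\<integral>\<^sup>+x. ennreal ((cmod (f n x - h x))\<^sup>2) \<partial>M) = (\<integral>\<^sup>+x. liminf (\<lambda>k. ennreal ((cmod (f n x - f (r k) x))\<^sup>2)) \<partial>M)"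
      by (rule nn_integral_cong_AE)
    also have "\<dots> \<le> liminf (\<lambda>k. \<integral>\<^sup>+x. ennreal ((cmod (f n x - f (r k) x))\<^sup>2) \<partial>M)"
      by (rule nn_integral_liminf) measurable
    also have "\<dots> \<le> ennreal e"
    proof (rule Liminf_le)
      have "\<forall>\<^sub>F k in sequentially. k \<ge> N e" by (rule eventually_ge_at_top)
      then show "\<forall>\<^sub>F k in sequentially. (\<integral>\<^sup>+x. ennreal ((cmod (f n x - f (r k) x))\<^sup>2) \<partial>M) \<le> ennreal e"
        by eventually_elim (use e n rk order_trans in \<open>blast intro: N\<close>)
    qed simp
    finally show ?thesis .
  qed
  have "(\<lambda>n. \<integral>\<^sup>+x. ennreal ((cmod (f n x - h x))\<^sup>2) \<partial>M) \<longlonglongrightarrow> 0"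
  proof (rule order_tendstoI)
    fix a :: ennreal assume "0 < a"
    then obtain b where b: "0 < b" "b < a" using dense by blast
    then obtain e where e: "b = ennreal e" "e > 0" by (cases b) (auto simp: ennreal_less_zero_iff)
    have "\<forall>\<^sub>F n in sequentially. n \<ge> N e" by (rule eventually_ge_at_top)
    then show "\<forall>\<^sub>F n in sequentially. (\<integral>\<^sup>+x. ennreal ((cmod (f n x - h x))\<^sup>2) \<partial>M) < a"
      by eventually_elim (use bound e b in \<open>blast intro: le_less_trans\<close>)
  qed auto
  with h show ?thesis by blast
qed

lemma power2_cmod_diff_le: "(cmod (a - b))\<^sup>2 \<le> 2 * (cmod a)\<^sup>2 + 2 * (cmod b)\<^sup>2"
proof -
  have "(cmod (a - b))\<^sup>2 \<le> (cmod a + cmod b)\<^sup>2" by (intro power_mono norm_triangle_ineq4) simp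
  also have "\<dots> \<le> 2 * (cmod a)\<^sup>2 + 2 * (cmod b)\<^sup>2"
    using sum_squares_bound[of "cmod a" "cmod b"] by (simp add: power2_sum)
  finally show ?thesis .
qed

lemma square_integrable_diff:
  assumes f: "square_integrable f" and g: "square_integrable g"
  shows "square_integrable (\<lambda>z. f z - g z)"
proof -
  have [measurable]: "f \<in> borel_measurable borel" "g \<in> borel_measurable borel"
    using f g by (auto simp: square_integrable_def)
  have "(\<integral>\<^sup>+ z. ennreal ((cmod (f z - g z))\<^sup>2) \<partial>lborel)
      \<le> (\<integral>\<^sup>+ z. 2 * ennreal ((cmod (f z))\<^sup>2) + 2 * ennreal ((cmod (g z))\<^sup>2) \<partial>lborel)"
  proof (intro nn_integral_mono)
    fix z
    have "2 * ennreal ((cmod (f z))\<^sup>2) + 2 * ennreal ((cmod (g z))\<^sup>2) = ennreal (2 * (cmod (f z))\<^sup>2 + 2 * (cmod (g z))\<^sup>2)"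
      by (simp add: ennreal_mult)
    then show "ennreal ((cmod (f z - g z))\<^sup>2) \<le> 2 * ennreal ((cmod (f z))\<^sup>2) + 2 * ennreal ((cmod (g z))\<^sup>2)"
      using power2_cmod_diff_le[of "f z" "g z"] by (simp only: ennreal_leI)
  qed
  also have "\<dots> = 2 * (\<integral>\<^sup>+ z. ennreal ((cmod (f z))\<^sup>2) \<partial>lborel) + 2 * (\<integral>\<^sup>+ z. ennreal ((cmod (g z))\<^sup>2) \<partial>lborel)"
    by (simp add: nn_integral_add nn_integral_cmult)
  also have "\<dots> < \<infinity>"
    using f g by (simp add: square_integrable_def ennreal_mult_less_top)
  finally show ?thesis by (simp add: square_integrable_def)
qed

text \<open>The truncations of \<open>g\<close> to balls are integrable, and by Bessel's inequality their
  transforms are Cauchy in \<open>L\<^sup>2\<close>.\<close>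

lemma L2_fourier_exists:
  fixes g :: "real^'n \<Rightarrow> complex"
  assumes g: "square_integrable g"
  shows "\<exists>h. is_L2_fourier g h"
proof -
  have [measurable]: "g \<in> borel_measurable borel"
    and fin: "(\<integral>\<^sup>+ z. ennreal ((cmod (g z))\<^sup>2) \<partial>lborel) < \<infinity>"
    using g by (auto simp: square_integrable_def)
  define t where "t n z = (if norm z \<le> real n then g z else 0)" for n :: nat and z
  have [measurable]: "t n \<in> borel_measurable borel" for n
    unfolding t_def[abs_def] by measurable
  have g2: "integrable lborel (\<lambda>z. (cmod (g z))\<^sup>2)"
    using fin by (intro integrableI_nonneg) auto
  have t: "integrable lborel (t n)" for n
  proof (rule Bochner_Integration.integrable_bound)
    show "integrable lborel (\<lambda>z. indicator (cball 0 (real n)) z + (cmod (g z))\<^sup>2)"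
      by (intro Bochner_Integration.integrable_add g2 integrable_real_indicator) (auto intro: emeasure_lborel_cball_finite[simplified])
    show "AE z in lborel. norm (t n z) \<le> norm (indicator (cball 0 (real n)) z + (cmod (g z))\<^sup>2)"
    proof (rule AE_I2)
      fix z
      have "cmod (g z) \<le> 1 + (cmod (g z))\<^sup>2"
        using sum_squares_bound[of 1 "cmod (g z)"] by (simp add: power2_eq_square) (smt (verit) zero_le_square norm_ge_zero)
      then show "norm (t n z) \<le> norm (indicator (cball 0 (real n)) z + (cmod (g z))\<^sup>2)"
        by (auto simp: t_def indicator_def)
    qed
  qed simp
  have diff: "fourier_integral (t m) \<omega> - fourier_integral (t n) \<omega> = fourier_integral (\<lambda>z. t m z - t n z) \<omega>" for m n \<omega>
    using fourier_integral_linear[OF t t, of 1 m "-1" n \<omega>] by simp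
  define C where "C = (2 * pi) ^ CARD('n)"
  have C: "C > 0" by (simp add: C_def)
  define tail where "tail N = (\<integral>\<^sup>+ z. (if norm z > real N then ennreal ((cmod (g z))\<^sup>2) else 0) \<partial>lborel)" for N :: nat
  have tail: "tail \<longlonglongrightarrow> 0"
  proof -
    have "tail \<longlonglongrightarrow> (\<integral>\<^sup>+ z. 0 \<partial>(lborel :: (real^'n) measure))"
      unfolding tail_def
    proof (rule nn_integral_dominated_convergence[where w="\<lambda>z. ennreal ((cmod (g z))\<^sup>2)"])
      show "AE z in lborel. (\<lambda>N. if norm z > real N then ennreal ((cmod (g z))\<^sup>2) else 0) \<longlonglongrightarrow> 0"
      proof (rule AE_I2)
        fix z :: "real^'n"
        have "\<forall>\<^sub>F N in sequentially. real N \<ge> norm z"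
          using filterlim_real_sequentially by (auto simp: filterlim_at_top)
        then have "\<forall>\<^sub>F N in sequentially. (if norm z > real N then ennreal ((cmod (g z))\<^sup>2) else 0) = 0"
          by eventually_elim auto
        then show "(\<lambda>N. if norm z > real N then ennreal ((cmod (g z))\<^sup>2) else 0) \<longlonglongrightarrow> 0"
          by (rule tendsto_eventually)
      qed
    qed (use fin in auto)
    then show ?thesis by simp
  qed
  have "\<exists>h\<in>borel_measurable lborel. (\<lambda>n. \<integral>\<^sup>+x. ennreal ((cmod (fourier_integral (t n) x - h x))\<^sup>2) \<partial>lborel) \<longlonglongrightarrow> 0"
  proof (rule L2_complete)
    fix e :: real assume e: "e > 0"
    then have "\<forall>\<^sub>F N in sequentially. tail N < ennreal (e / C)"
      using C tail by (intro order_tendstoD) (auto simp: ennreal_less_zero_iff)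
    then obtain N where N: "tail N < ennreal (e / C)" by (auto simp: eventually_sequentially)
    have "(\<integral>\<^sup>+x. ennreal ((cmod (fourier_integral (t m) x - fourier_integral (t n) x))\<^sup>2) \<partial>lborel) \<le> ennreal e"
      if "m \<ge> N" "n \<ge> N" for m n
    proof -
      have "(\<integral>\<^sup>+x. ennreal ((cmod (fourier_integral (t m) x - fourier_integral (t n) x))\<^sup>2) \<partial>lborel)
          \<le> ennreal C * (\<integral>\<^sup>+z. ennreal ((cmod (t m z - t n z))\<^sup>2) \<partial>lborel)"
        unfolding diff C_def using t by (intro fourier_integral_bessel) auto
      also have "\<dots> \<le> ennreal C * tail N"
        unfolding tail_def using that
        by (intro mult_left_mono nn_integral_mono) (auto simp: t_def)
      also have "\<dots> \<le> ennreal C * ennreal (e / C)"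
        using N by (intro mult_left_mono) auto
      also have "\<dots> = ennreal e" using C e by (simp flip: ennreal_mult)
      finally show ?thesis .
    qed
    then show "\<exists>N. \<forall>m\<ge>N. \<forall>n\<ge>N. (\<integral>\<^sup>+x. ennreal ((cmod (fourier_integral (t m) x - fourier_integral (t n) x))\<^sup>2) \<partial>lborel) \<le> ennreal e"
      by blast
  qed simp
  then obtain h where h: "h \<in> borel_measurable lborel"
    and lim: "(\<lambda>n. \<integral>\<^sup>+x. ennreal ((cmod (fourier_integral (t n) x - h x))\<^sup>2) \<partial>lborel) \<longlonglongrightarrow> 0" by blast
  have "\<forall>\<^sub>F n in sequentially. (\<integral>\<^sup>+x. ennreal ((cmod (fourier_integral (t n) x - h x))\<^sup>2) \<partial>lborel) < 1"
    using lim by (rule order_tendstoD) simp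
  then obtain n where n: "(\<integral>\<^sup>+x. ennreal ((cmod (fourier_integral (t n) x - h x))\<^sup>2) \<partial>lborel) < 1"
    by (auto simp: eventually_sequentially)
  have "(\<integral>\<^sup>+z. ennreal ((cmod (t n z))\<^sup>2) \<partial>lborel) \<le> (\<integral>\<^sup>+z. ennreal ((cmod (g z))\<^sup>2) \<partial>lborel)"
    by (intro nn_integral_mono) (auto simp: t_def)
  then have "(\<integral>\<^sup>+z. ennreal ((cmod (t n z))\<^sup>2) \<partial>lborel) < \<infinity>" using fin by (rule le_less_trans)
  then have "square_integrable (fourier_integral (t n))"
    using le_less_trans[OF fourier_integral_bessel[OF t[of n]]] by (auto simp: square_integrable_def ennreal_mult_less_top)
  moreover have "square_integrable (\<lambda>x. fourier_integral (t n) x - h x)"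
    using n h by (auto simp: square_integrable_def intro: less_trans)
  ultimately have "square_integrable (\<lambda>x. fourier_integral (t n) x - (fourier_integral (t n) x - h x))"
    by (rule square_integrable_diff)
  then show ?thesis
    using lim unfolding is_L2_fourier_def t_def[abs_def] by auto
qed

text \<open>Where \<^const>\<open>fourier\<close> chooses a limit in the mean, measurability is only known
  because such a limit exists.  Without it, a finite RKHS norm would not force the transform to vanish
  off the support of the spectral density.\<close>

lemma borel_measurable_fourier:
  fixes g :: "real^'n \<Rightarrow> complex"
  assumes "square_integrable g"
  shows "fourier g \<in> borel_measurable borel"
proof (cases "integrable lborel g")
  case True
  then have "g \<in> borel_measurable borel" by (auto dest: borel_measurable_integrable)
  with True show ?thesis by (auto simp: fourier_def)
next
  case False
  then have "is_L2_fourier g (fourier g)"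
    using assms someI_ex[OF L2_fourier_exists[OF assms]] by (simp add: fourier_def)
  then show ?thesis by (simp add: is_L2_fourier_def square_integrable_def)
qed


section \<open>The spectrum of the sinc-4 kernel\<close>

lemma abs_sinc_le_1: "\<bar>sinc x\<bar> \<le> 1"
  using abs_sin_x_le_abs_x[of x] by (simp add: divide_le_eq)

text \<open>The decay that makes the fourth power of sinc integrable.\<close>

lemma sinc_power4_le: "sinc x ^ 4 \<le> 2 * inverse (1 + x\<^sup>2)"
proof (cases "\<bar>x\<bar> \<le> 1")
  case True
  have "sinc x ^ 4 = \<bar>sinc x\<bar> ^ 4" by simp
  also have "\<dots> \<le> 1" using abs_sinc_le_1 by (intro power_le_one) auto
  also have "1 \<le> 2 * inverse (1 + x\<^sup>2)"
    using True by (simp add: field_simps abs_square_le_1 add_pos_nonneg)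
  finally show ?thesis .
next
  case False
  then have x: "x \<noteq> 0" "1 < x\<^sup>2" using one_less_power[of "\<bar>x\<bar>" 2] by auto
  have "sinc x ^ 4 = \<bar>sin x\<bar> ^ 4 / (x\<^sup>2)\<^sup>2" using x by (simp add: power_divide)
  also have "\<dots> \<le> 1 / (x\<^sup>2)\<^sup>2" by (intro divide_right_mono power_le_one) auto
  also have "\<dots> \<le> 1 / x\<^sup>2"
    using x mult_left_mono[of 1 "x\<^sup>2" "x\<^sup>2"] by (intro divide_left_mono) (auto simp: power2_eq_square[of "x\<^sup>2"])
  also have "\<dots> \<le> 2 * inverse (1 + x\<^sup>2)" using x by (simp add: field_simps)
  finally show ?thesis .
qed

lemma integrable_sinc_power4:
  assumes "c \<noteq> 0"
  shows "integrable lborel (\<lambda>x. sinc (x * c) ^ 4)"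
proof -
  have "integrable lborel (\<lambda>x::real. inverse (1 + x\<^sup>2))"
    using integrable_inverse_1_plus_square by (simp add: set_integrable_def)
  then have "integrable lborel (\<lambda>x::real. 2 * inverse (1 + (0 + c * x)\<^sup>2))"
    by (intro integrable_mult_right lborel_integrable_real_affine assms)
  then show ?thesis
  proof (rule Bochner_Integration.integrable_bound)
    show "AE x in lborel. norm (sinc (x * c) ^ 4) \<le> norm (2 * inverse (1 + (0 + c * x)\<^sup>2))"
    proof (rule AE_I2)
      fix x
      have "norm (sinc (x * c) ^ 4) = sinc (x * c) ^ 4"
        unfolding real_norm_def by (rule abs_of_nonneg) (rule zero_le_even_power, simp)
      also have "\<dots> \<le> 2 * inverse (1 + (x * c)\<^sup>2)" by (rule sinc_power4_le)
      also have "\<dots> \<le> norm (2 * inverse (1 + (0 + c * x)\<^sup>2))" by (simp add: mult.commute)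
      finally show "norm (sinc (x * c) ^ 4) \<le> norm (2 * inverse (1 + (0 + c * x)\<^sup>2))" .
    qed
  qed simp
qed

lemma integrable_sinc4:
  assumes "\<tau> > 0"
  shows "integrable lborel (sinc4 \<tau> :: real^'n \<Rightarrow> complex)"
proof -
  have eq: "sinc4 \<tau> = (\<lambda>u::real^'n. \<Prod>i\<in>UNIV. complex_of_real (sinc (u $ i * (1 / (4 * \<tau>))) ^ 4))"
    unfolding sinc4_def[abs_def] by (simp only: of_real_prod divide_inverse mult_1)
  show ?thesis
    unfolding eq using assms by (intro lborel_vec_prod_integrable integrable_of_real integrable_sinc_power4) simp
qed

lemma square_integrable_if_le_1:
  assumes f: "integrable lborel f" and B: "\<And>z. cmod (f z) \<le> 1"
  shows "square_integrable f"
proof -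
  have "(\<integral>\<^sup>+ z. ennreal ((cmod (f z))\<^sup>2) \<partial>lborel) \<le> (\<integral>\<^sup>+ z. ennreal (cmod (f z)) \<partial>lborel)"
    using B by (intro nn_integral_mono ennreal_leI) (simp add: power2_eq_square mult_left_le)
  also have "\<dots> < \<infinity>" using f by (simp add: integrable_iff_bounded)
  finally show ?thesis using f by (auto simp: square_integrable_def)
qed

lemma square_integrable_sinc4:
  assumes "\<tau> > 0"
  shows "square_integrable (sinc4 \<tau> :: real^'n \<Rightarrow> complex)"
proof (rule square_integrable_if_le_1[OF integrable_sinc4[OF assms]])
  fix z :: "real^'n"
  have "cmod (sinc4 \<tau> z) = (\<Prod>i\<in>UNIV. \<bar>sinc (z $ i / (4 * \<tau>))\<bar> ^ 4)"
    unfolding sinc4_def norm_of_real abs_prod power_abs ..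
  also have "\<dots> \<le> 1"
    by (intro prod_le_1 conjI power_le_one abs_sinc_le_1) auto
  finally show "cmod (sinc4 \<tau> z) \<le> 1" .
qed

definition cube :: "real \<Rightarrow> (real^'n) set" where
  "cube r = {x. \<forall>i. \<bar>x $ i\<bar> \<le> r}"

lemma indicator_cube: "indicator (cube r) x = (\<Prod>i\<in>UNIV. indicator {-r..r} (x $ i) :: complex)"
  by (auto simp: cube_def indicator_def abs_le_iff prod_zero_iff minus_le_iff intro: order_trans)

lemma integral_interval_character:
  assumes "r > 0"
  shows "(LINT x|lborel. indicator {-r..r} x * exp (- \<i> * of_real (u * x))) = complex_of_real (2 * r * sinc (r * u))"
proof (cases "u = 0")
  case True
  have "(LINT x|lborel. complex_of_real (indicator {-r..r} x)) = of_real (2 * r)"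
    using assms by (subst integral_complex_of_real) simp
  then show ?thesis using True by (simp add: of_real_indicator)
next
  case False
  define F where "F x = exp (- \<i> * of_real (u * x)) / (- \<i> * of_real u)" for x :: real
  have "(LINT x|lborel. indicator {-r..r} x *\<^sub>R exp (- \<i> * of_real (u * x))) = F r - F (-r)"
  proof (rule integral_FTC_Icc)
    show "(F has_vector_derivative exp (- \<i> * of_real (u * x))) (at x within {-r..r})" for x
      unfolding F_def using False
      by (auto intro!: derivative_eq_intros has_vector_derivative_real_field simp: field_simps)
  qed (use assms in \<open>auto intro!: continuous_intros\<close>)
  also have "F r - F (-r) = of_real (2 * r * sinc (r * u))"
  proof -
    have "exp (- \<i> * of_real (u * r)) = cis (- (u * r))" "exp (- \<i> * of_real (u * - r)) = cis (u * r)"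
      by (simp_all add: cis_conv_exp)
    then show ?thesis
      using False assms unfolding F_def by (simp add: complex_eq_iff field_simps Re_divide Im_divide power2_eq_square)
  qed
  finally show ?thesis by (simp add: scaleR_conv_of_real of_real_indicator)
qed

lemma integrable_indicator_interval: "integrable lborel (indicator {-r..r::real} :: real \<Rightarrow> complex)"
proof -
  have "integrable lborel (\<lambda>x. complex_of_real (indicator {-r..r} x))"
    by (intro integrable_of_real integrable_real_indicator) (auto simp: emeasure_lborel_Icc_eq)
  then show ?thesis by (simp add: of_real_indicator)
qed

lemma integrable_indicator_cube: "integrable lborel (indicator (cube r) :: real^'n \<Rightarrow> complex)"
  unfolding indicator_cube[abs_def]
  by (rule lborel_vec_prod_integrable) (rule integrable_indicator_interval)

lemma fourier_integral_cube:
  assumes "r > 0"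
  shows "fourier_integral (indicator (cube r)) (u :: real^'n) = of_real ((2 * r) ^ CARD('n) * (\<Prod>i\<in>UNIV. sinc (r * u $ i)))"
  unfolding indicator_cube[abs_def]
  by (subst fourier_integral_prod)
     (auto intro!: integrable_indicator_interval simp: integral_interval_character[OF assms, simplified] prod.distrib power_mult_distrib)

text \<open>The bound \<open>B\<close> off the cube stands in for vanishing there: the Gaussian \<open>gauss t\<close>
  satisfies it with \<open>B\<close> tending to 0 as \<open>t\<close> does, whereas its transform vanishes nowhere.\<close>

definition spectrum_concentrated :: "(real^'n \<Rightarrow> complex) \<Rightarrow> real \<Rightarrow> real \<Rightarrow> bool" where
  "spectrum_concentrated k s B \<longleftrightarrow> integrable lborel k
     \<and> (\<forall>\<omega>. Im (fourier_integral k \<omega>) = 0 \<and> 0 \<le> Re (fourier_integral k \<omega>))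
     \<and> (\<forall>\<omega>. \<omega> \<notin> cube s \<longrightarrow> Re (fourier_integral k \<omega>) \<le> B)"

text \<open>The product of the sincs is the normalised transform of the indicator of
  \<open>cube r\<close>.  By the multiplication formula, multiplying \<open>k\<close> by it replaces the transform of \<open>k\<close> at \<open>\<omega>\<close>
  by its mean over \<open>\<omega> + cube r\<close>.  Means preserve nonnegativity and bounds, and the mean at \<open>\<omega>\<close> only
  sees values off \<open>cube s\<close> if \<open>\<omega>\<close> lies off \<open>cube (s + r)\<close>.\<close>

lemma spectrum_concentrated_sinc_mult:
  fixes k :: "real^'n \<Rightarrow> complex"
  assumes k: "spectrum_concentrated k s B" and r: "r > 0"
  shows "spectrum_concentrated (\<lambda>u. of_real (\<Prod>i\<in>UNIV. sinc (r * u $ i)) * k u) (s + r) B"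
proof -
  have int: "integrable lborel k" and re: "\<And>\<omega>. Im (fourier_integral k \<omega>) = 0" "\<And>\<omega>. 0 \<le> Re (fourier_integral k \<omega>)"
    and B: "\<And>\<omega>. \<omega> \<notin> cube s \<Longrightarrow> Re (fourier_integral k \<omega>) \<le> B"
    using k by (auto simp: spectrum_concentrated_def)
  define q where "q u = complex_of_real (\<Prod>i\<in>UNIV. sinc (r * u $ i)) * k u" for u
  have [measurable]: "k \<in> borel_measurable borel" using int by (auto dest: borel_measurable_integrable)
  have "cmod (complex_of_real (\<Prod>i\<in>UNIV. sinc (r * u $ i))) \<le> 1" for u :: "real^'n"
    unfolding norm_of_real abs_prod by (intro prod_le_1 conjI abs_sinc_le_1) auto
  then have q: "integrable lborel q"
    unfolding q_def mult.commute[of _ "k _"]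
    by (rule integrable_mult_bounded[OF int, rotated]) measurable
  define V where "V = (2 * r) ^ CARD('n)"
  have V: "V > 0" using r by (simp add: V_def)
  define h where "h \<omega> x = indicator (cube r) x * fourier_integral k (\<omega> + x)" for \<omega> x :: "real^'n"
  have h: "integrable lborel (h \<omega>)" for \<omega>
    unfolding h_def
    by (rule integrable_mult_bounded[OF integrable_indicator_cube, where B="LINT z|lborel. cmod (k z)"])
       (auto intro!: cmod_fourier_integral_le measurable_compose[OF _ borel_measurable_fourier_integral])
  have Fq: "of_real V * fourier_integral q \<omega> = (LINT x|lborel. h \<omega> x)" for \<omega>
  proof -
    have c: "exp (- \<i> * of_real (\<omega> \<bullet> u)) = exp (\<i> * of_real ((- \<omega>) \<bullet> u))" for u by simp
    have "of_real V * fourier_integral q \<omega>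
       = (LINT u|lborel. fourier_integral (indicator (cube r)) u * (exp (\<i> * of_real ((- \<omega>) \<bullet> u)) * k u))"
      unfolding fourier_integral_def[of q] c fourier_integral_cube[OF r]
      by (subst integral_mult_right_zero[symmetric]) (simp add: q_def V_def mult_ac)
    also have "\<dots> = (LINT x|lborel. indicator (cube r) x * fourier_integral (\<lambda>u. exp (\<i> * of_real ((- \<omega>) \<bullet> u)) * k u) x)"
    proof (rule fourier_integral_mult_formula[OF integrable_indicator_cube])
      show "integrable lborel (\<lambda>u. exp (\<i> * of_real ((- \<omega>) \<bullet> u)) * k u)"
        using integrable_character[OF int, of \<omega>] by (simp add: mult.commute)
    qed
    finally show ?thesis
      unfolding fourier_integral_modulate by (simp add: h_def add.commute)
  qed
  have Im: "V * Im (fourier_integral q \<omega>) = (LINT x|lborel. Im (h \<omega> x))" for \<omega>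
    using arg_cong[OF Fq, of Im \<omega>] h[of \<omega>] by simp
  have Re: "V * Re (fourier_integral q \<omega>) = (LINT x|lborel. Re (h \<omega> x))" for \<omega>
    using arg_cong[OF Fq, of Re \<omega>] h[of \<omega>] by simp
  have vol: "(LINT x|lborel. Re (indicator (cube r) (x :: real^'n))) = V"
    using fourier_integral_cube[OF r, of "0 :: real^'n"] integrable_indicator_cube[of r, where 'n='n]
    by (simp add: fourier_integral_def V_def) 
  have "Im (fourier_integral q \<omega>) = 0" for \<omega>
  proof -
    have "Im (h \<omega> x) = 0" for x by (simp add: h_def re indicator_def)
    then show ?thesis using Im[of \<omega>] V by simp
  qed
  moreover have "0 \<le> Re (fourier_integral q \<omega>)" for \<omega>
  proof -
    have "0 \<le> (LINT x|lborel. Re (h \<omega> x))"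
      by (intro Bochner_Integration.integral_nonneg) (simp add: h_def re indicator_def)
    then show ?thesis using Re[of \<omega>] V by (metis zero_le_mult_iff not_less)
  qed
  moreover have "Re (fourier_integral q \<omega>) \<le> B" if \<omega>: "\<omega> \<notin> cube (s + r)" for \<omega>
  proof -
    have "(LINT x|lborel. Re (h \<omega> x)) \<le> (LINT x|lborel. B * Re (indicator (cube r) (x :: real^'n)))"
    proof (rule Bochner_Integration.integral_mono)
      fix x
      show "Re (h \<omega> x) \<le> B * Re (indicator (cube r) x)"
      proof (cases "x \<in> cube r")
        case True
        from \<omega> obtain i where "\<bar>\<omega> $ i\<bar> > s + r" by (auto simp: cube_def not_le)
        moreover have "\<bar>x $ i\<bar> \<le> r" using True by (simp add: cube_def)
        ultimately have "\<bar>(\<omega> + x) $ i\<bar> > s" by simp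
        then have "\<omega> + x \<notin> cube s" by (auto simp: cube_def not_le intro!: exI[of _ i])
        then show ?thesis using B True by (simp add: h_def)
      qed (simp add: h_def)
    qed (use h integrable_indicator_cube in auto)
    also have "\<dots> = B * V" using vol by simp
    finally have "V * Re (fourier_integral q \<omega>) \<le> V * B" unfolding Re by (simp add: mult.commute)
    then show ?thesis using V by simp
  qed
  ultimately have "spectrum_concentrated q (s + r) B"
    using q by (simp add: spectrum_concentrated_def)
  then show ?thesis by (simp only: q_def[abs_def])
qed

lemma low_freq_eq_cube: "low_freq \<tau> = cube (1 / \<tau>)"
  by (auto simp: low_freq_def cube_def abs_le_iff minus_le_iff)

text \<open>The sinc-4 function is the fourth power of a product of sincs with \<open>r = 1 / (4 * \<tau>)\<close>.
  Multiplied by a Gaussian that flattens to 1, it has a transform that is four times averaged over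
  \<open>cube r\<close>, so it is nonnegative and nearly vanishes off \<open>cube (\<delta> + 4 * r)\<close>; both properties survive the
  limit, for every \<open>\<delta> > 0\<close>.\<close>

lemma spectrum_sinc4:
  fixes \<omega> :: "real^'n"
  assumes \<tau>: "\<tau> > 0"
  shows "Im (fourier_integral (sinc4 \<tau>) \<omega>) = 0" 
    and "0 \<le> Re (fourier_integral (sinc4 \<tau>) \<omega>)"
    and "\<omega> \<notin> low_freq \<tau> \<Longrightarrow> fourier_integral (sinc4 \<tau>) \<omega> = 0"
proof -
  define r where "r = 1 / (4 * \<tau>)"
  have r: "r > 0" using \<tau> by (simp add: r_def)
  define q :: "real^'n \<Rightarrow> complex" where "q u = of_real (\<Prod>i\<in>UNIV. sinc (r * u $ i))" for u
  define s where "s n = 1 / real (Suc n)" for n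
  have s: "s n > 0" for n by (simp add: s_def)
  define G where "G n u = q u * (q u * (q u * (q u * gauss (s n) u)))" for n u
  have "q u = of_real (\<Prod>i\<in>UNIV. sinc (u $ i / (4 * \<tau>)))" for u
    unfolding q_def r_def by (simp only: divide_inverse mult_1 mult.commute)
  then have "sinc4 \<tau> u = q u ^ 4" for u
    by (simp only: sinc4_def prod_power_distrib of_real_power[symmetric])
  then have G: "G n u = sinc4 \<tau> u * gauss (s n) u" for n u
    by (simp only: G_def power4_eq_xxxx mult.assoc)
  define B where "B \<delta> n = (sqrt (2 * pi) / s n) ^ CARD('n) * exp (- (\<delta> / s n)\<^sup>2 / 2)" for \<delta> n
  have conc: "spectrum_concentrated (G n) (\<delta> + r + r + r + r) (B \<delta> n)" if "\<delta> > 0" for \<delta> n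
  proof -
    have "spectrum_concentrated (gauss (s n) :: real^'n \<Rightarrow> complex) \<delta> (B \<delta> n)"
    proof -
      have "gauss_spectrum (s n) \<omega> \<le> B \<delta> n" if "\<omega> \<notin> cube \<delta>" for \<omega> :: "real^'n"
      proof -
        from that obtain i where "\<bar>\<omega> $ i\<bar> > \<delta>" by (auto simp: cube_def not_le)
        then have "\<delta> \<le> norm \<omega>" using component_le_norm_cart[of \<omega> i] by simp
        then show ?thesis unfolding B_def using \<open>\<delta> > 0\<close> s by (intro gauss_spectrum_le) auto
      qed
      then show ?thesis
        using s by (simp add: spectrum_concentrated_def integrable_gauss fourier_integral_gauss gauss_spectrum_nonneg)
    qed
    then show ?thesis
      unfolding G_def q_def by (intro spectrum_concentrated_sinc_mult r)
  qed
  have lim: "(\<lambda>n. fourier_integral (G n) \<omega>) \<longlonglongrightarrow> fourier_integral (sinc4 \<tau>) \<omega>" for \<omega>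
    unfolding fourier_integral_def G
  proof (rule integral_dominated_convergence[where w="\<lambda>u. cmod (sinc4 \<tau> u)"])
    show "(\<lambda>u::real^'n. sinc4 \<tau> u * exp (- \<i> * of_real (\<omega> \<bullet> u))) \<in> borel_measurable lborel"
      using integrable_character[OF integrable_sinc4[OF \<tau>]] by (rule borel_measurable_integrable)
    show "(\<lambda>u::real^'n. sinc4 \<tau> u * gauss (s i) u * exp (- \<i> * of_real (\<omega> \<bullet> u))) \<in> borel_measurable lborel" for i
      using conc[of 1 i] unfolding spectrum_concentrated_def G[abs_def]
      by (intro borel_measurable_integrable integrable_character) auto
    show "integrable lborel (\<lambda>u::real^'n. cmod (sinc4 \<tau> u))"
      by (intro integrable_norm integrable_sinc4 \<tau>)
    show "AE u in lborel. norm (sinc4 \<tau> u * gauss (s i) u * exp (- \<i> * of_real (\<omega> \<bullet> u))) \<le> cmod (sinc4 \<tau> u)" for i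
      by (rule AE_I2) (simp add: norm_mult gauss_def mult_left_le)
    show "AE u in lborel. (\<lambda>i. sinc4 \<tau> u * gauss (s i) u * exp (- \<i> * of_real (\<omega> \<bullet> u)))
        \<longlonglongrightarrow> sinc4 \<tau> u * exp (- \<i> * of_real (\<omega> \<bullet> u))"
    proof (rule AE_I2)
      fix u :: "real^'n"
      have "(\<lambda>i. sinc4 \<tau> u * of_real (exp (- (s i * norm u)\<^sup>2 / 2)) * exp (- \<i> * of_real (\<omega> \<bullet> u)))
        \<longlonglongrightarrow> sinc4 \<tau> u * of_real (exp (- (0 * norm u)\<^sup>2 / 2)) * exp (- \<i> * of_real (\<omega> \<bullet> u))"
        unfolding s_def by (intro tendsto_intros LIMSEQ_Suc[OF lim_1_over_n]) auto
      then show "(\<lambda>i. sinc4 \<tau> u * gauss (s i) u * exp (- \<i> * of_real (\<omega> \<bullet> u)))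
        \<longlonglongrightarrow> sinc4 \<tau> u * exp (- \<i> * of_real (\<omega> \<bullet> u))"
        by (simp add: gauss_def)
    qed
  qed
  have limIm: "(\<lambda>n. Im (fourier_integral (G n) \<omega>)) \<longlonglongrightarrow> Im (fourier_integral (sinc4 \<tau>) \<omega>)"
   and limRe: "(\<lambda>n. Re (fourier_integral (G n) \<omega>)) \<longlonglongrightarrow> Re (fourier_integral (sinc4 \<tau>) \<omega>)" for \<omega>
    using lim by (auto intro: tendsto_intros)
  have "Im (fourier_integral (G n) \<omega>) = 0" "0 \<le> Re (fourier_integral (G n) \<omega>)" for n \<omega>
    using conc[of 1 n] by (auto simp: spectrum_concentrated_def)
  then show Im: "Im (fourier_integral (sinc4 \<tau>) \<omega>) = 0" and Re: "0 \<le> Re (fourier_integral (sinc4 \<tau>) \<omega>)"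
    using limIm[of \<omega>] by (simp_all add: LIMSEQ_const_iff LIMSEQ_le_const[OF limRe])
  show "fourier_integral (sinc4 \<tau>) \<omega> = 0" if "\<omega> \<notin> low_freq \<tau>"
  proof -
    from that obtain i where i: "\<bar>\<omega> $ i\<bar> > 1 / \<tau>" by (auto simp: low_freq_eq_cube cube_def not_le)
    \<comment> \<open>Small enough that \<open>\<omega>\<close> still lies off \<open>cube (\<delta> + 4 * r)\<close>.\<close>
    define \<delta> where "\<delta> = (\<bar>\<omega> $ i\<bar> - 1 / \<tau>) / 2"
    have \<delta>: "\<delta> > 0" using i by (simp add: \<delta>_def)
    have "4 * r = 1 / \<tau>" using \<tau> by (simp add: r_def)
    then have "\<delta> + r + r + r + r < \<bar>\<omega> $ i\<bar>" using i unfolding \<delta>_def by argo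
    then have "\<omega> \<notin> cube (\<delta> + r + r + r + r)" by (auto simp: cube_def not_le)
    then have le: "Re (fourier_integral (G n) \<omega>) \<le> B \<delta> n" for n
      using conc[OF \<delta>, of n] by (auto simp: spectrum_concentrated_def)
    have "(\<lambda>n. B \<delta> n) \<longlonglongrightarrow> 0"
      unfolding B_def s_def by (rule gauss_spectrum_bound_tendsto_0[OF \<delta>])
    then have "Re (fourier_integral (sinc4 \<tau>) \<omega>) \<le> 0"
      using le by (intro LIMSEQ_le[OF limRe]) auto
    with Re Im show ?thesis by (simp add: complex_eq_iff)
  qed
qed


section \<open>Spectral multipliers\<close>

text \<open>The functions that are both integrable and square-integrable are the candidates for members of an RKHS
  whose transform is the Fourier integral itself.  A multiplier maps this class to itself, so that multipliers can be
  composed; this is what makes them a ring.\<close>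

definition spectral_multiplier :: "(real^'n \<Rightarrow> complex) \<Rightarrow> bool" where
  "spectral_multiplier E \<longleftrightarrow> (\<forall>g. integrable lborel g \<and> square_integrable g \<longrightarrow>
     (\<exists>g'. integrable lborel g' \<and> square_integrable g' \<and> (\<forall>\<omega>. fourier_integral g' \<omega> = E \<omega> * fourier_integral g \<omega>)))"

lemma square_integrable_cmult:
  assumes g: "square_integrable g"
  shows "square_integrable (\<lambda>z. a * g z)"
proof -
  have [measurable]: "g \<in> borel_measurable borel" using g by (simp add: square_integrable_def)
  have "(\<integral>\<^sup>+ z. ennreal ((cmod (a * g z))\<^sup>2) \<partial>lborel) = ennreal ((cmod a)\<^sup>2) * (\<integral>\<^sup>+ z. ennreal ((cmod (g z))\<^sup>2) \<partial>lborel)"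
    by (subst nn_integral_cmult[symmetric]) (auto simp: norm_mult power_mult_distrib ennreal_mult)
  also have "\<dots> < \<infinity>" using g by (simp add: square_integrable_def ennreal_mult_less_top)
  finally show ?thesis by (simp add: square_integrable_def)
qed

lemma spectral_multiplier_linear:
  fixes E E' :: "real^'n \<Rightarrow> complex"
  assumes E: "spectral_multiplier E" "spectral_multiplier E'"
  shows "spectral_multiplier (\<lambda>\<omega>. a * E \<omega> + b * E' \<omega>)"
  unfolding spectral_multiplier_def
proof (intro allI impI)
  fix g :: "real^'n \<Rightarrow> complex" assume g: "integrable lborel g \<and> square_integrable g"
  obtain k where k: "integrable lborel k" "square_integrable k" "\<And>\<omega>. fourier_integral k \<omega> = E \<omega> * fourier_integral g \<omega>"
    using E(1) g unfolding spectral_multiplier_def by metis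
  obtain l where l: "integrable lborel l" "square_integrable l" "\<And>\<omega>. fourier_integral l \<omega> = E' \<omega> * fourier_integral g \<omega>"
    using E(2) g unfolding spectral_multiplier_def by metis
  have "square_integrable (\<lambda>z. a * k z - (- b) * l z)"
    by (intro square_integrable_diff square_integrable_cmult k l)
  then have "square_integrable (\<lambda>z. a * k z + b * l z)" by simp
  moreover have "fourier_integral (\<lambda>z. a * k z + b * l z) \<omega> = (a * E \<omega> + b * E' \<omega>) * fourier_integral g \<omega>" for \<omega>
    by (simp add: fourier_integral_linear k l algebra_simps)
  moreover have "integrable lborel (\<lambda>z. a * k z + b * l z)" using k l by auto
  ultimately show "\<exists>g'. integrable lborel g' \<and> square_integrable g' \<and>
      (\<forall>\<omega>. fourier_integral g' \<omega> = (a * E \<omega> + b * E' \<omega>) * fourier_integral g \<omega>)" by blast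
qed

lemma spectral_multiplier_mult:
  fixes E E' :: "real^'n \<Rightarrow> complex"
  assumes "spectral_multiplier E" "spectral_multiplier E'"
  shows "spectral_multiplier (\<lambda>\<omega>. E \<omega> * E' \<omega>)"
  using assms unfolding spectral_multiplier_def by (metis mult.assoc)

lemma spectral_multiplier_one: "spectral_multiplier (\<lambda>\<omega>. 1)"
  unfolding spectral_multiplier_def by auto

text \<open>Translating \<open>g\<close> by \<open>s\<close> multiplies its transform by a character.\<close>

lemma spectral_multiplier_character:
  fixes s :: "real^'n"
  shows "spectral_multiplier (\<lambda>\<omega>. exp (\<i> * of_real (\<omega> \<bullet> s)))"
  unfolding spectral_multiplier_def
proof (intro allI impI)
  fix g :: "real^'n \<Rightarrow> complex" assume g: "integrable lborel g \<and> square_integrable g"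
  then have [measurable]: "g \<in> borel_measurable borel" by (simp add: square_integrable_def)
  define k where "k z = g (s + z)" for z
  have T: "distr lborel borel ((+) s) = lborel" by (rule lborel_distr_plus)
  have "integrable (distr lborel borel ((+) s)) g" unfolding T using g by simp
  then have k: "integrable lborel k"
    unfolding k_def by (subst (asm) integrable_distr_eq) auto
  have "(\<integral>\<^sup>+ z. ennreal ((cmod (k z))\<^sup>2) \<partial>lborel) = (\<integral>\<^sup>+ z. ennreal ((cmod (g z))\<^sup>2) \<partial>lborel)"
    using nn_integral_translate[of "\<lambda>z. ennreal ((cmod (g z))\<^sup>2)" s] by (simp add: k_def add.commute)
  with g k have sq: "square_integrable k" by (simp add: square_integrable_def k_def)
  have "fourier_integral k \<omega> = exp (\<i> * of_real (\<omega> \<bullet> s)) * fourier_integral g \<omega>" for \<omega>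
  proof -
    have "fourier_integral g \<omega> = (LINT z|distr lborel borel ((+) s). g z * exp (- \<i> * of_real (\<omega> \<bullet> z)))"
      unfolding T fourier_integral_def ..
    also have "\<dots> = (LINT z|lborel. k z * exp (- \<i> * of_real (\<omega> \<bullet> (s + z))))"
      unfolding k_def by (rule integral_distr) simp_all
    also have "\<dots> = (LINT z|lborel. exp (- \<i> * of_real (\<omega> \<bullet> s)) * (k z * exp (- \<i> * of_real (\<omega> \<bullet> z))))"
      by (simp add: inner_add_right distrib_left exp_add mult_ac exp_diff exp_minus divide_inverse)
    also have "\<dots> = exp (- \<i> * of_real (\<omega> \<bullet> s)) * fourier_integral k \<omega>"
      unfolding fourier_integral_def by (rule integral_mult_right_zero)
    finally show ?thesis by (simp add: mult.assoc[symmetric] exp_add[symmetric])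
  qed
  with k sq show "\<exists>g'. integrable lborel g' \<and> square_integrable g' \<and>
      (\<forall>\<omega>. fourier_integral g' \<omega> = exp (\<i> * of_real (\<omega> \<bullet> s)) * fourier_integral g \<omega>)" by blast
qed

text \<open>Up to a phase, the sine is a difference of two characters.  The shift by \<open>x\<close> makes it vanish at
  \<open>x\<close>, so such functions separate points.\<close>

lemma spectral_multiplier_sin:
  fixes s x :: "real^'n"
  shows "spectral_multiplier (\<lambda>\<omega>. of_real (sin ((\<omega> - x) \<bullet> s)))"
proof -
  have "complex_of_real (sin ((\<omega> - x) \<bullet> s)) =
      (exp (- \<i> * of_real (x \<bullet> s)) / (2 * \<i>)) * exp (\<i> * of_real (\<omega> \<bullet> s))
      + (- exp (\<i> * of_real (x \<bullet> s)) / (2 * \<i>)) * exp (\<i> * of_real (\<omega> \<bullet> (- s)))" for \<omega>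
  proof -
    have "complex_of_real (sin ((\<omega> - x) \<bullet> s)) = (exp (\<i> * of_real ((\<omega> - x) \<bullet> s)) - exp (- (\<i> * of_real ((\<omega> - x) \<bullet> s)))) / (2 * \<i>)"
      by (simp only: sin_of_real[symmetric] sin_exp_eq)
    then show ?thesis
      by (simp add: inner_diff_left exp_diff exp_minus diff_divide_distrib algebra_simps) (simp add: field_simps)
  qed
  then show ?thesis
    by (simp only:) (intro spectral_multiplier_linear spectral_multiplier_character)
qed

text \<open>Real-valued continuous multipliers form a ring that separates points, so Stone-Weierstrass applies.\<close>

lemma spectral_multiplier_dense:
  fixes \<psi> :: "real^'n \<Rightarrow> real"
  assumes "compact S" "continuous_on UNIV \<psi>" "e > 0"
  shows "\<exists>p. (continuous_on UNIV p \<and> spectral_multiplier (\<lambda>\<omega>. of_real (p \<omega>))) \<and> (\<forall>\<omega>\<in>S. \<bar>\<psi> \<omega> - p \<omega>\<bar> < e)"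
proof (rule Stone_Weierstrass_HOL[OF \<open>compact S\<close>])
  show "continuous_on UNIV (\<lambda>x. c) \<and> spectral_multiplier (\<lambda>\<omega>. of_real c)" for c :: real
    using spectral_multiplier_linear[OF spectral_multiplier_one spectral_multiplier_one, of "of_real c" 0] by simp
next
  fix p q :: "real^'n \<Rightarrow> real"
  assume pq: "(continuous_on UNIV p \<and> spectral_multiplier (\<lambda>\<omega>. of_real (p \<omega>))) 
            \<and> (continuous_on UNIV q \<and> spectral_multiplier (\<lambda>\<omega>. of_real (q \<omega>)))"
  show "continuous_on UNIV (\<lambda>x. p x + q x) \<and> spectral_multiplier (\<lambda>\<omega>. of_real (p \<omega> + q \<omega>))"
    using pq spectral_multiplier_linear[of "\<lambda>\<omega>. of_real (p \<omega>)" "\<lambda>\<omega>. of_real (q \<omega>)" 1 1]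
    by (auto intro: continuous_intros)
  show "continuous_on UNIV (\<lambda>x. p x * q x) \<and> spectral_multiplier (\<lambda>\<omega>. of_real (p \<omega> * q \<omega>))"
    using pq spectral_multiplier_mult[of "\<lambda>\<omega>. of_real (p \<omega>)" "\<lambda>\<omega>. of_real (q \<omega>)"]
    by (auto intro: continuous_intros)
next
  fix x y :: "real^'n" assume xy: "x \<in> S \<and> y \<in> S \<and> x \<noteq> y"
  define s where "s = (1 / ((y - x) \<bullet> (y - x))) *\<^sub>R (y - x)"
  have "y \<noteq> x" using xy by blast
  then have "(y - x) \<bullet> s = 1" by (simp add: s_def)
  then have "sin ((y - x) \<bullet> s) \<noteq> 0" using sin_gt_zero[of 1] pi_gt3 by simp
  then have "sin ((x - x) \<bullet> s) \<noteq> sin ((y - x) \<bullet> s)" by simp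
  then show "\<exists>f. (continuous_on UNIV f \<and> spectral_multiplier (\<lambda>\<omega>. of_real (f \<omega>))) \<and> f x \<noteq> f y"
    by (intro exI[of _ "\<lambda>\<omega>. sin ((\<omega> - x) \<bullet> s)"]) (auto intro!: spectral_multiplier_sin continuous_intros)
qed (use assms continuous_on_subset in auto)

text \<open>The squares of multipliers are a rich enough family of weights: a continuous
  function approximates the indicator of \<open>{\<omega>. w \<omega> < 0}\<close> almost everywhere, a multiplier
  approximates it uniformly on \<open>S\<close>, and the square of an indicator is the indicator itself.  In the limit the
  integral of \<open>w\<close> over that set is nonnegative, so the set is null.\<close>

lemma AE_nonneg_if_multiplier_squares_nonneg:
  fixes w :: "real^'n \<Rightarrow> real"
  assumes w: "integrable lborel w" and S: "compact S" and supp: "\<And>\<omega>. \<omega> \<notin> S \<Longrightarrow> w \<omega> = 0"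
    and nonneg: "\<And>p. continuous_on UNIV p \<Longrightarrow> spectral_multiplier (\<lambda>\<omega>. of_real (p \<omega>))
       \<Longrightarrow> 0 \<le> (LINT \<omega>|lborel. (p \<omega>)\<^sup>2 * w \<omega>)"
  shows "AE \<omega> in lborel. 0 \<le> w \<omega>"
proof -
  have [measurable]: "w \<in> borel_measurable borel" using w by (auto dest: borel_measurable_integrable)
  define A where "A = {\<omega>. w \<omega> < 0}"
  have A[measurable]: "A \<in> sets borel" unfolding A_def by measurable
  have "(indicator A :: real^'n \<Rightarrow> real) measurable_on UNIV"
    by (rule lebesgue_measurable_imp_measurable_on) (auto intro!: measurable_completion)
  then obtain N and g :: "nat \<Rightarrow> real^'n \<Rightarrow> real" where N: "negligible N" and g: "\<And>n. continuous_on UNIV (g n)"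
    and glim: "\<And>x. x \<notin> N \<Longrightarrow> (\<lambda>n. g n x) \<longlonglongrightarrow> indicator A x"
    unfolding measurable_on_def by auto
  define \<psi> where "\<psi> n x = max 0 (min 1 (g n x))" for n x
  have "\<exists>p. (continuous_on UNIV p \<and> spectral_multiplier (\<lambda>\<omega>. of_real (p \<omega>))) \<and> (\<forall>\<omega>\<in>S. \<bar>\<psi> n \<omega> - p \<omega>\<bar> < 1 / real (Suc n))" for n
    using S g unfolding \<psi>_def by (intro spectral_multiplier_dense) (auto intro!: continuous_intros)
  then obtain p where p: "\<And>n. continuous_on UNIV (p n)" "\<And>n. spectral_multiplier (\<lambda>\<omega>. of_real (p n \<omega>))"
    and close: "\<And>n \<omega>. \<omega> \<in> S \<Longrightarrow> \<bar>\<psi> n \<omega> - p n \<omega>\<bar> < 1 / real (Suc n)" by metis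
  have [measurable]: "p n \<in> borel_measurable borel" for n
    using p(1) by (rule borel_measurable_continuous_onI)
  have AE_N: "AE x in lborel. x \<notin> N"
    using N AE_completion_iff[of "\<lambda>x. x \<notin> N" lborel] AE_not_in negligible_iff_null_sets by blast
  have plim: "(\<lambda>n. (p n \<omega>)\<^sup>2 * w \<omega>) \<longlonglongrightarrow> indicator A \<omega> * w \<omega>" if "\<omega> \<notin> N" for \<omega>
  proof (cases "\<omega> \<in> S")
    case True
    have "(\<lambda>n. \<psi> n \<omega>) \<longlonglongrightarrow> max 0 (min 1 (indicator A \<omega>))"
      unfolding \<psi>_def by (intro tendsto_intros glim that)
    then have "(\<lambda>n. \<psi> n \<omega>) \<longlonglongrightarrow> indicator A \<omega>" by (simp add: indicator_def split: if_splits)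
    moreover have "(\<lambda>n. \<psi> n \<omega> - p n \<omega>) \<longlonglongrightarrow> 0"
    proof (rule Lim_null_comparison)
      show "\<forall>\<^sub>F n in sequentially. norm (\<psi> n \<omega> - p n \<omega>) \<le> 1 / real (Suc n)"
        using close[OF True] by (intro always_eventually allI less_imp_le) (simp only: real_norm_def)
      show "(\<lambda>n. 1 / real (Suc n)) \<longlonglongrightarrow> 0" by (rule LIMSEQ_Suc[OF lim_1_over_n])
    qed
    ultimately have "(\<lambda>n. \<psi> n \<omega> - (\<psi> n \<omega> - p n \<omega>)) \<longlonglongrightarrow> indicator A \<omega> - 0" by (rule tendsto_diff)
    then have "(\<lambda>n. (p n \<omega>)\<^sup>2 * w \<omega>) \<longlonglongrightarrow> (indicator A \<omega>)\<^sup>2 * w \<omega>" by (intro tendsto_intros) simp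
    then show ?thesis by (cases "\<omega> \<in> A") simp_all
  qed (simp add: supp)
  have "(\<lambda>n. LINT \<omega>|lborel. (p n \<omega>)\<^sup>2 * w \<omega>) \<longlonglongrightarrow> (LINT \<omega>|lborel. indicator A \<omega> * w \<omega>)"
  proof (rule integral_dominated_convergence[where w="\<lambda>\<omega>. 4 * \<bar>w \<omega>\<bar>"])
    show "AE \<omega> in lborel. norm ((p n \<omega>)\<^sup>2 * w \<omega>) \<le> 4 * \<bar>w \<omega>\<bar>" for n
    proof (rule AE_I2)
      fix \<omega>
      show "norm ((p n \<omega>)\<^sup>2 * w \<omega>) \<le> 4 * \<bar>w \<omega>\<bar>"
      proof (cases "\<omega> \<in> S")
        case True
        have "\<bar>\<psi> n \<omega>\<bar> \<le> 1" by (simp add: \<psi>_def)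
        moreover have "1 / real (Suc n) \<le> 1" by simp
        ultimately have "\<bar>p n \<omega>\<bar> \<le> 2" using close[OF True, of n] by linarith
        then have "(p n \<omega>)\<^sup>2 \<le> 4" using power_mono[of "\<bar>p n \<omega>\<bar>" 2 2] by simp
        then show ?thesis by (simp add: abs_mult mult_right_mono)
      qed (simp add: supp)
    qed
    show "AE \<omega> in lborel. (\<lambda>n. (p n \<omega>)\<^sup>2 * w \<omega>) \<longlonglongrightarrow> indicator A \<omega> * w \<omega>"
      using AE_N by eventually_elim (rule plim)
  qed (use w in auto)
  then have "0 \<le> (LINT \<omega>|lborel. indicator A \<omega> * w \<omega>)"
    by (rule LIMSEQ_le_const) (use nonneg[OF p] in auto)
  moreover have "integrable lborel (\<lambda>\<omega>. - (indicator A \<omega> * w \<omega>))"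
    using integrable_mult_indicator[of A lborel w] w A by simp
  moreover have "0 \<le> - (indicator A \<omega> * w \<omega>)" for \<omega> by (simp add: A_def indicator_def)
  moreover have "0 \<le> (LINT \<omega>|lborel. - (indicator A \<omega> * w \<omega>))"
    by (rule Bochner_Integration.integral_nonneg) (simp add: A_def indicator_def)
  ultimately have "AE \<omega> in lborel. - (indicator A \<omega> * w \<omega>) = 0"
    by (subst integral_nonneg_eq_0_iff_AE[symmetric]) auto
  then show ?thesis by eventually_elim (auto simp: A_def indicator_def split: if_splits)
qed


section \<open>Essential infima and low frequencies\<close>

text \<open>A countable sequence increasing to the essential infimum replaces the uncountably many values
  below it.\<close>

lemma essinf_AE:
  fixes f :: "'a \<Rightarrow> 'b::{second_countable_topology, dense_linorder, linorder_topology, complete_linorder}"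
  shows "AE x in M. essinf M f \<le> f x"
proof (cases "f \<in> borel_measurable M \<and> essinf M f \<noteq> bot")
  case True
  then have eq: "essinf M f = Liminf (ae_filter M) f" by (simp add: essinf_def)
  obtain u :: "nat \<Rightarrow> 'b" where u: "\<And>n. u n < essinf M f" "u \<longlonglongrightarrow> essinf M f"
    using approx_from_below_dense_linorder[of bot "essinf M f"] True by (auto simp: bot.not_eq_extremum)
  have "AE x in M. u n < f x" for n
    using less_LiminfD[of "u n" "ae_filter M" f] u(1)[of n] by (simp add: eq)
  then have "AE x in M. \<forall>n. u n < f x" by (simp add: AE_all_countable)
  then show ?thesis
  proof eventually_elim
    case (elim x)
    then show ?case by (intro LIMSEQ_le_const2[OF u(2)]) (auto intro: less_imp_le)
  qed
qed (auto simp: essinf_def)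

lemma fourier_integrable: "integrable lborel g \<Longrightarrow> fourier g = fourier_integral g"
  by (simp add: fourier_def)

lemma translation_invariant_kernelD:
  assumes "translation_invariant_kernel \<rho>"
  shows "(\<lambda>\<omega>. Re (fourier \<rho> \<omega>)) \<in> borel_measurable borel"
    and "AE \<omega> in lborel. 0 \<le> Re (fourier \<rho> \<omega>) \<and> Im (fourier \<rho> \<omega>) = 0"
proof -
  have "fourier \<rho> \<in> borel_measurable borel"
    using assms by (auto simp: translation_invariant_kernel_def dest!: borel_measurable_integrable)
  then show "(\<lambda>\<omega>. Re (fourier \<rho> \<omega>)) \<in> borel_measurable borel" by measurable
  show "AE \<omega> in lborel. 0 \<le> Re (fourier \<rho> \<omega>) \<and> Im (fourier \<rho> \<omega>) = 0"
    using assms by (auto simp: translation_invariant_kernel_def)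
qed

lemma closed_low_freq: "closed (low_freq \<tau> :: (real^'n) set)"
proof -
  have "low_freq \<tau> = (\<Inter>i. {\<omega> :: real^'n. - (1 / \<tau>) \<le> \<omega> $ i} \<inter> {\<omega>. \<omega> $ i \<le> 1 / \<tau>})"
    by (auto simp: low_freq_def)
  also have "closed \<dots>"
    by (intro closed_INT ballI closed_Int closed_Collect_le continuous_intros)
  finally show ?thesis .
qed

lemma compact_low_freq: "compact (low_freq \<tau> :: (real^'n) set)"
proof -
  have "norm \<omega> \<le> (\<Sum>i\<in>(UNIV :: 'n set). 1 / \<tau>)" if "\<omega> \<in> low_freq \<tau>" for \<omega> :: "real^'n"
  proof -
    have "norm \<omega> \<le> (\<Sum>i\<in>UNIV. \<bar>\<omega> $ i\<bar>)" by (rule norm_le_l1_cart)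
    also have "\<dots> \<le> (\<Sum>i\<in>(UNIV :: 'n set). 1 / \<tau>)"
      using that by (intro sum_mono) (simp add: low_freq_eq_cube cube_def)
    finally show ?thesis .
  qed
  then have "bounded (low_freq \<tau> :: (real^'n) set)" by (auto simp: bounded_iff)
  then show ?thesis using closed_low_freq by (simp add: compact_eq_bounded_closed)
qed

lemma AE_low_freq_iff:
  "(AE \<omega> in restrict_space lborel (low_freq \<tau>). P \<omega>) \<longleftrightarrow> (AE \<omega> :: real^'n in lborel. \<omega> \<in> low_freq \<tau> \<longrightarrow> P \<omega>)"
  by (rule AE_restrict_space_iff) (simp add: borel_closed closed_low_freq)


section \<open>Comparison of RKHS norms\<close>

text \<open>The comparison is pointwise under the integral.  Where the density of \<open>\<rho>\<close> is positive it
  is the hypothesis; where that density vanishes, finiteness of the norm of \<open>g\<close> forces the transform of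
  \<open>g\<close> to vanish almost everywhere, as \<open>x / 0 = \<infinity>\<close> for \<open>x > 0\<close>.\<close>

lemma rkhs_norm_sq_le:
  fixes \<rho> \<rho>' g :: "real^'n \<Rightarrow> complex" and k :: real
  assumes k: "0 \<le> k" and g: "g \<in> rkhs \<rho>"
    and [measurable]: "(\<lambda>\<omega>. Re (fourier \<rho> \<omega>)) \<in> borel_measurable borel"
    and dom: "AE \<omega> in lborel. 0 < Re (fourier \<rho> \<omega>) \<longrightarrow>
       0 < Re (fourier \<rho>' \<omega>) \<and> Re (fourier \<rho> \<omega>) \<le> k\<^sup>2 * Re (fourier \<rho>' \<omega>)"
  shows "rkhs_norm_sq \<rho>' g \<le> ennreal (k\<^sup>2) * rkhs_norm_sq \<rho> g"
proof -
  let ?F = "\<lambda>\<omega>. ennreal ((cmod (fourier g \<omega>))\<^sup>2)"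
  let ?c = "ennreal (1 / (2 * pi) ^ CARD('n))"
  have sq: "square_integrable g" and fin: "rkhs_norm_sq \<rho> g < \<infinity>" using g by (auto simp: rkhs_def)
  have [measurable]: "fourier g \<in> borel_measurable borel" using sq by (rule borel_measurable_fourier)
  have "?c > 0" by (simp add: ennreal_zero_less_divide)
  then have "(\<integral>\<^sup>+ \<omega>. ?F \<omega> / ennreal (Re (fourier \<rho> \<omega>)) \<partial>lborel) < \<infinity>"
    using fin by (auto simp: rkhs_norm_sq_def ennreal_mult_less_top)
  then have "AE \<omega> in lborel. ?F \<omega> / ennreal (Re (fourier \<rho> \<omega>)) \<noteq> \<infinity>"
    by (intro nn_integral_PInf_AE) auto
  with dom have "AE \<omega> in lborel. ?F \<omega> / ennreal (Re (fourier \<rho>' \<omega>)) \<le> ennreal (k\<^sup>2) * (?F \<omega> / ennreal (Re (fourier \<rho> \<omega>)))"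
  proof eventually_elim
    case (elim \<omega>)
    show ?case
    proof (cases "0 < Re (fourier \<rho> \<omega>)")
      case True
      with elim have p: "0 < Re (fourier \<rho>' \<omega>)" "Re (fourier \<rho> \<omega>) \<le> k\<^sup>2 * Re (fourier \<rho>' \<omega>)" by auto
      have "(cmod (fourier g \<omega>))\<^sup>2 * Re (fourier \<rho> \<omega>) \<le> (cmod (fourier g \<omega>))\<^sup>2 * (k\<^sup>2 * Re (fourier \<rho>' \<omega>))"
        by (intro mult_left_mono p) auto
      then have "(cmod (fourier g \<omega>))\<^sup>2 / Re (fourier \<rho>' \<omega>) \<le> k\<^sup>2 * ((cmod (fourier g \<omega>))\<^sup>2 / Re (fourier \<rho> \<omega>))"
        using True p by (simp add: field_simps)
      then show ?thesis
        using True p by (simp add: divide_ennreal ennreal_leI flip: ennreal_mult)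
    next
      case False
      then have "ennreal (Re (fourier \<rho> \<omega>)) = 0" by (simp add: ennreal_neg)
      then have "?F \<omega> = 0" using elim by (metis ennreal_divide_zero infinity_ennreal_def)
      then show ?thesis by simp
    qed
  qed
  then have "(\<integral>\<^sup>+ \<omega>. ?F \<omega> / ennreal (Re (fourier \<rho>' \<omega>)) \<partial>lborel)
      \<le> (\<integral>\<^sup>+ \<omega>. ennreal (k\<^sup>2) * (?F \<omega> / ennreal (Re (fourier \<rho> \<omega>))) \<partial>lborel)"
    by (rule nn_integral_mono_AE)
  also have "\<dots> = ennreal (k\<^sup>2) * (\<integral>\<^sup>+ \<omega>. ?F \<omega> / ennreal (Re (fourier \<rho> \<omega>)) \<partial>lborel)"
    by (rule nn_integral_cmult) measurable
  finally show ?thesis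
    unfolding rkhs_norm_sq_def by (subst mult.left_commute) (rule mult_left_mono, auto)
qed

lemma rkhs_norm_le:
  assumes "0 \<le> k" "rkhs_norm_sq \<rho>' g \<le> ennreal (k\<^sup>2) * rkhs_norm_sq \<rho> g" "rkhs_norm_sq \<rho> g < \<infinity>"
  shows "rkhs_norm \<rho>' g \<le> k * rkhs_norm \<rho> g"
proof -
  have "enn2real (rkhs_norm_sq \<rho>' g) \<le> enn2real (ennreal (k\<^sup>2) * rkhs_norm_sq \<rho> g)"
    using assms by (intro enn2real_mono) (auto simp: ennreal_mult_less_top)
  also have "\<dots> = k\<^sup>2 * enn2real (rkhs_norm_sq \<rho> g)" by (simp add: enn2real_mult)
  finally have "rkhs_norm \<rho>' g \<le> sqrt (k\<^sup>2 * enn2real (rkhs_norm_sq \<rho> g))"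
    by (simp add: rkhs_norm_def)
  then show ?thesis using assms(1) by (simp add: real_sqrt_mult rkhs_norm_def)
qed

lemma rkhs_norm_sq_le_of_norm:
  assumes "rkhs_norm \<rho>' g \<le> c * rkhs_norm \<rho> g" "0 \<le> c" "rkhs_norm_sq \<rho>' g < \<infinity>" "rkhs_norm_sq \<rho> g < \<infinity>"
  shows "rkhs_norm_sq \<rho>' g \<le> ennreal (c\<^sup>2) * rkhs_norm_sq \<rho> g"
proof -
  have "(rkhs_norm \<rho>' g)\<^sup>2 \<le> (c * rkhs_norm \<rho> g)\<^sup>2"
    by (rule power_mono[OF assms(1)]) (simp add: rkhs_norm_def)
  then have "enn2real (rkhs_norm_sq \<rho>' g) \<le> c\<^sup>2 * enn2real (rkhs_norm_sq \<rho> g)"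
    by (simp add: rkhs_norm_def power_mult_distrib)
  then have "ennreal (enn2real (rkhs_norm_sq \<rho>' g)) \<le> ennreal (c\<^sup>2) * ennreal (enn2real (rkhs_norm_sq \<rho> g))"
    by (simp add: ennreal_leI flip: ennreal_mult)
  then show ?thesis using assms by simp
qed

lemma C_switch_le:
  assumes k: "0 \<le> k"
    and le: "\<And>g. g \<in> rkhs \<rho> \<Longrightarrow> rkhs_norm_sq \<rho>' g \<le> ennreal (k\<^sup>2) * rkhs_norm_sq \<rho> g"
  shows "C_switch \<rho> \<rho>' \<le> ennreal k" and "rkhs_continuously_embeds \<rho> \<rho>'"
proof -
  have fin: "rkhs_norm_sq \<rho> g < \<infinity>" if "g \<in> rkhs \<rho>" for g using that by (simp add: rkhs_def)
  have sub: "rkhs \<rho> \<subseteq> rkhs \<rho>'"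
  proof
    fix g assume g: "g \<in> rkhs \<rho>"
    then have "rkhs_norm_sq \<rho>' g < \<infinity>"
      using le_less_trans[OF le[OF g]] fin[OF g] by (auto simp: ennreal_mult_less_top)
    with g show "g \<in> rkhs \<rho>'" by (simp add: rkhs_def)
  qed
  have norm: "rkhs_norm \<rho>' g \<le> k * rkhs_norm \<rho> g" if "g \<in> rkhs \<rho>" for g
    using that by (intro rkhs_norm_le k le fin)
  then show "rkhs_continuously_embeds \<rho> \<rho>'"
    using sub by (auto simp: rkhs_continuously_embeds_def)
  have "rkhs_norm \<rho>' g / rkhs_norm \<rho> g \<le> k" if "g \<in> rkhs \<rho>" for g
  proof (cases "rkhs_norm \<rho> g = 0")
    case False
    then have "rkhs_norm \<rho> g > 0" by (simp add: rkhs_norm_def less_le)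
    then show ?thesis using norm[OF that] by (simp add: field_simps)
  qed (use k in simp)
  then show "C_switch \<rho> \<rho>' \<le> ennreal k"
    using sub by (auto simp: C_switch_def intro!: SUP_least ennreal_leI)
qed

text \<open>In \<^const>\<open>C_switch\<close> the quotient is one of real numbers, with \<open>x / 0 = 0\<close>, so it bounds
  the norm only where the pivot norm is nonzero.\<close>

lemma rkhs_norm_le_C_switch:
  assumes C: "C_switch \<rho> \<rho>' = ennreal c" "0 \<le> c"
    and g: "g \<in> rkhs \<rho>" "\<not> (AE z in lborel. g z = 0)"
    and pos: "rkhs_norm \<rho> g \<noteq> 0"
  shows "rkhs_norm \<rho>' g \<le> c * rkhs_norm \<rho> g"
proof -
  have sub: "rkhs \<rho> \<subseteq> rkhs \<rho>'" using C by (auto simp: C_switch_def split: if_splits)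
  have "ennreal (rkhs_norm \<rho>' g / rkhs_norm \<rho> g) \<le> C_switch \<rho> \<rho>'"
    using sub g by (auto simp: C_switch_def intro!: SUP_upper)
  then have "rkhs_norm \<rho>' g / rkhs_norm \<rho> g \<le> c" using C by simp
  moreover have "rkhs_norm \<rho> g > 0" using pos by (simp add: rkhs_norm_def less_le)
  ultimately show ?thesis by (simp add: field_simps)
qed

text \<open>Test functions whose transform is \<open>p * \<phi>\<close>, with \<open>p\<close> a multiplier and \<open>\<phi>\<close> the
  transform of \<open>\<Psi>\<close>, have squared norms \<open>\<integral> p\<^sup>2 * \<phi>\<close> and \<open>\<integral> p\<^sup>2 * \<phi>\<^sup>2 / m\<close> in the two spaces, up to a
  common factor.  So \<open>c\<^sup>2 * \<phi> - \<phi>\<^sup>2 / m\<close> has a nonnegative integral against every \<open>p\<^sup>2\<close>, which makes it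
  nonnegative almost everywhere.\<close>

lemma spectral_ratio_le_C_switch:
  fixes \<Psi> \<rho> :: "real^'n \<Rightarrow> complex"
  assumes \<Psi>: "integrable lborel \<Psi>" "square_integrable \<Psi>"
    and real: "\<And>\<omega>. Im (fourier_integral \<Psi> \<omega>) = 0" "\<And>\<omega>. 0 \<le> Re (fourier_integral \<Psi> \<omega>)"
    and S: "compact S" and supp: "\<And>\<omega>. \<omega> \<notin> S \<Longrightarrow> fourier_integral \<Psi> \<omega> = 0"
    and m[measurable]: "(\<lambda>\<omega>. Re (fourier \<rho> \<omega>)) \<in> borel_measurable borel"
    and mpos: "AE \<omega> in lborel. \<omega> \<in> S \<longrightarrow> 0 < Re (fourier \<rho> \<omega>)"
    and C: "C_switch \<Psi> \<rho> = ennreal c" "0 \<le> c"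
  shows "AE \<omega> in lborel. \<omega> \<in> S \<longrightarrow> sqrt (Re (fourier \<Psi> \<omega>) / Re (fourier \<rho> \<omega>)) \<le> c"
proof -
  define \<phi> where "\<phi> \<omega> = Re (fourier_integral \<Psi> \<omega>)" for \<omega>
  define m where "m \<omega> = Re (fourier \<rho> \<omega>)" for \<omega>
  define \<kappa> where "\<kappa> = 1 / (2 * pi) ^ CARD('n)"
  have \<kappa>: "\<kappa> > 0" by (simp add: \<kappa>_def)
  have [measurable]: "\<Psi> \<in> borel_measurable borel" using \<Psi> by (auto dest: borel_measurable_integrable)
  have [measurable]: "\<phi> \<in> borel_measurable borel" "m \<in> borel_measurable borel"
    unfolding \<phi>_def[abs_def] m_def[abs_def] by measurable
  have F\<Psi>: "fourier_integral \<Psi> \<omega> = of_real (\<phi> \<omega>)" for \<omega>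
    by (simp add: \<phi>_def complex_eq_iff real)
  have f\<Psi>: "Re (fourier \<Psi> \<omega>) = \<phi> \<omega>" for \<omega> by (simp add: fourier_integrable[OF \<Psi>(1)] \<phi>_def)
  have \<phi>0: "0 \<le> \<phi> \<omega>" for \<omega> by (simp add: \<phi>_def real)
  have \<phi>S: "\<phi> \<omega> = 0" if "\<omega> \<notin> S" for \<omega> using supp[OF that] by (simp add: \<phi>_def)
  have sub: "rkhs \<Psi> \<subseteq> rkhs \<rho>" using C by (auto simp: C_switch_def split: if_splits)
  obtain B where B: "\<And>\<omega>. \<phi> \<omega> \<le> B"
    using cmod_fourier_integral_le[of \<Psi>] complex_Re_le_cmod order_trans unfolding \<phi>_def by metis
  have Sm[measurable]: "S \<in> sets borel" using S by (simp add: borel_compact)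
  have fS: "emeasure lborel S < \<infinity>" using S by (intro emeasure_bounded_finite compact_imp_bounded)
  have int: "integrable lborel (\<lambda>\<omega>. (p \<omega>)\<^sup>2 * \<phi> \<omega>)" if p: "continuous_on UNIV p" for p :: "real^'n \<Rightarrow> real"
  proof -
    have [measurable]: "p \<in> borel_measurable borel" using p by (rule borel_measurable_continuous_onI)
    have "compact (p ` S)" using S p by (meson compact_continuous_image continuous_on_subset subset_UNIV)
    then obtain D where D: "\<And>\<omega>. \<omega> \<in> S \<Longrightarrow> \<bar>p \<omega>\<bar> \<le> D"
      using compact_imp_bounded bounded_iff by (metis imageI real_norm_def)
    show ?thesis
    proof (rule Bochner_Integration.integrable_bound)
      show "integrable lborel (\<lambda>\<omega>. D\<^sup>2 * B * indicator S \<omega>)"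
        using fS by (intro integrable_mult_right integrable_real_indicator) auto
      show "AE \<omega> in lborel. norm ((p \<omega>)\<^sup>2 * \<phi> \<omega>) \<le> norm (D\<^sup>2 * B * indicator S \<omega>)"
      proof (rule AE_I2)
        fix \<omega>
        show "norm ((p \<omega>)\<^sup>2 * \<phi> \<omega>) \<le> norm (D\<^sup>2 * B * indicator S \<omega>)"
        proof (cases "\<omega> \<in> S")
          case True
          have "(p \<omega>)\<^sup>2 \<le> D\<^sup>2" using D[OF True] power_mono[of "\<bar>p \<omega>\<bar>" D 2] by simp
          then have "(p \<omega>)\<^sup>2 * \<phi> \<omega> \<le> D\<^sup>2 * \<bar>B\<bar>"
            by (intro mult_mono order_trans[OF B] \<phi>0) auto
          then show ?thesis using True by (simp add: abs_mult \<phi>0)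
        qed (simp add: \<phi>S)
      qed
    qed measurable
  qed
  have core: "(\<integral>\<^sup>+\<omega>. ennreal ((p \<omega>)\<^sup>2 * (\<phi> \<omega>)\<^sup>2) / ennreal (m \<omega>) \<partial>lborel) \<le> ennreal (c\<^sup>2) * ennreal (LINT \<omega>|lborel. (p \<omega>)\<^sup>2 * \<phi> \<omega>)"
    if p: "continuous_on UNIV p" and mult: "spectral_multiplier (\<lambda>\<omega>. of_real (p \<omega>))" for p :: "real^'n \<Rightarrow> real"
  proof -
    have [measurable]: "p \<in> borel_measurable borel" using p by (rule borel_measurable_continuous_onI)
    obtain g where g: "integrable lborel g" "square_integrable g"
        "\<And>\<omega>. fourier_integral g \<omega> = of_real (p \<omega>) * fourier_integral \<Psi> \<omega>"
      using mult \<Psi> unfolding spectral_multiplier_def by metis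
    have Fg: "(cmod (fourier g \<omega>))\<^sup>2 = (p \<omega>)\<^sup>2 * (\<phi> \<omega>)\<^sup>2" for \<omega>
      by (simp add: fourier_integrable[OF g(1)] g(3) F\<Psi> norm_mult power_mult_distrib)
    have "ennreal ((p \<omega>)\<^sup>2 * (\<phi> \<omega>)\<^sup>2) / ennreal (\<phi> \<omega>) = ennreal ((p \<omega>)\<^sup>2 * \<phi> \<omega>)" for \<omega>
    proof (cases "\<phi> \<omega> = 0")
      case False
      then have "0 < \<phi> \<omega>" using \<phi>0[of \<omega>] by simp
      then have "(p \<omega>)\<^sup>2 * (\<phi> \<omega>)\<^sup>2 / \<phi> \<omega> = (p \<omega>)\<^sup>2 * \<phi> \<omega>"
        by (simp add: power2_eq_square)
      then show ?thesis using \<open>0 < \<phi> \<omega>\<close> by (subst divide_ennreal) simp_all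
    qed simp
    then have N: "rkhs_norm_sq \<Psi> g = ennreal \<kappa> * ennreal (LINT \<omega>|lborel. (p \<omega>)\<^sup>2 * \<phi> \<omega>)"
      unfolding rkhs_norm_sq_def Fg f\<Psi> \<kappa>_def
      by (simp add: nn_integral_eq_integral[OF int[OF p]] \<phi>0)
    have N': "rkhs_norm_sq \<rho> g = ennreal \<kappa> * (\<integral>\<^sup>+\<omega>. ennreal ((p \<omega>)\<^sup>2 * (\<phi> \<omega>)\<^sup>2) / ennreal (m \<omega>) \<partial>lborel)"
      unfolding rkhs_norm_sq_def Fg m_def \<kappa>_def ..
    have gin: "g \<in> rkhs \<Psi>" using g by (simp add: rkhs_def N ennreal_mult_less_top)
    then have gin': "g \<in> rkhs \<rho>" using sub by blast
    have "rkhs_norm_sq \<rho> g \<le> ennreal (c\<^sup>2) * rkhs_norm_sq \<Psi> g"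
    \<comment> \<open>If this holds, \<open>g\<close> has pivot norm 0 and \<^const>\<open>C_switch\<close> gives no information, but both norms vanish.\<close>
    proof (cases "AE \<omega> in lborel. (p \<omega>)\<^sup>2 * \<phi> \<omega> = 0")
      case True
      then have "AE \<omega> in lborel. ennreal ((p \<omega>)\<^sup>2 * (\<phi> \<omega>)\<^sup>2) / ennreal (m \<omega>) = 0"
        by eventually_elim auto
      then have "(\<integral>\<^sup>+\<omega>. ennreal ((p \<omega>)\<^sup>2 * (\<phi> \<omega>)\<^sup>2) / ennreal (m \<omega>) \<partial>lborel) = 0"
        by (subst nn_integral_0_iff_AE) auto
      then show ?thesis unfolding N' by simp
    next
      case False
      have "(LINT \<omega>|lborel. (p \<omega>)\<^sup>2 * \<phi> \<omega>) \<noteq> 0"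
        using False integral_nonneg_eq_0_iff_AE[OF int[OF p]] \<phi>0 by auto
      moreover have "0 \<le> (LINT \<omega>|lborel. (p \<omega>)\<^sup>2 * \<phi> \<omega>)"
        using \<phi>0 by (intro Bochner_Integration.integral_nonneg) simp
      ultimately have "rkhs_norm \<Psi> g \<noteq> 0"
        using \<kappa> by (simp add: rkhs_norm_def N flip: ennreal_mult)
      moreover have "\<not> (AE z in lborel. g z = 0)"
      proof
        assume "AE z in lborel. g z = 0"
        then have "fourier_integral g \<omega> = 0" for \<omega>
          unfolding fourier_integral_def by (intro integral_eq_zero_AE) auto
        then have "p \<omega> * \<phi> \<omega> = 0" for \<omega> using g(3)[of \<omega>] by (simp add: F\<Psi>)
        with False show False by auto
      qed
      ultimately have "rkhs_norm \<rho> g \<le> c * rkhs_norm \<Psi> g"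
        using gin by (intro rkhs_norm_le_C_switch[OF C]) auto
      then show ?thesis
        using C gin gin' by (intro rkhs_norm_sq_le_of_norm) (auto simp: rkhs_def)
    qed
    then have "ennreal \<kappa> * (\<integral>\<^sup>+\<omega>. ennreal ((p \<omega>)\<^sup>2 * (\<phi> \<omega>)\<^sup>2) / ennreal (m \<omega>) \<partial>lborel)
        \<le> ennreal \<kappa> * (ennreal (c\<^sup>2) * ennreal (LINT \<omega>|lborel. (p \<omega>)\<^sup>2 * \<phi> \<omega>))"
      unfolding N N' by (simp add: mult.left_commute)
    then show ?thesis
      using \<kappa> by (subst (asm) ennreal_mult_le_mult_iff) auto
  qed
  \<comment> \<open>The case distinction keeps \<open>v\<close> nonnegative also on the null part of \<open>S\<close> where \<open>m\<close> may be negative.\<close>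
  define v where "v \<omega> = (if 0 < m \<omega> then (\<phi> \<omega>)\<^sup>2 / m \<omega> else 0)" for \<omega>
  have v0: "0 \<le> v \<omega>" for \<omega> by (simp add: v_def)
  have [measurable]: "v \<in> borel_measurable borel" unfolding v_def[abs_def] by measurable
  have nnv: "(\<integral>\<^sup>+\<omega>. ennreal ((p \<omega>)\<^sup>2 * v \<omega>) \<partial>lborel) = (\<integral>\<^sup>+\<omega>. ennreal ((p \<omega>)\<^sup>2 * (\<phi> \<omega>)\<^sup>2) / ennreal (m \<omega>) \<partial>lborel)" for p
  proof (rule nn_integral_cong_AE)
    show "AE \<omega> in lborel. ennreal ((p \<omega>)\<^sup>2 * v \<omega>) = ennreal ((p \<omega>)\<^sup>2 * (\<phi> \<omega>)\<^sup>2) / ennreal (m \<omega>)"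
      using mpos
    proof eventually_elim
      case (elim \<omega>)
      show ?case
      proof (cases "\<omega> \<in> S")
        case True
        then have "0 < m \<omega>" using elim by (simp add: m_def)
        then show ?thesis by (simp add: v_def divide_ennreal)
      qed (simp add: v_def \<phi>S)
    qed
  qed
  have intv: "integrable lborel (\<lambda>\<omega>. (p \<omega>)\<^sup>2 * v \<omega>)" 
    and lev: "(LINT \<omega>|lborel. (p \<omega>)\<^sup>2 * v \<omega>) \<le> c\<^sup>2 * (LINT \<omega>|lborel. (p \<omega>)\<^sup>2 * \<phi> \<omega>)"
    if p: "continuous_on UNIV p" "spectral_multiplier (\<lambda>\<omega>. of_real (p \<omega>))" for p :: "real^'n \<Rightarrow> real"
  proof -
    have [measurable]: "p \<in> borel_measurable borel" using p(1) by (rule borel_measurable_continuous_onI)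
    have I: "0 \<le> (LINT \<omega>|lborel. (p \<omega>)\<^sup>2 * \<phi> \<omega>)"
      using \<phi>0 by (intro Bochner_Integration.integral_nonneg) simp
    have le: "(\<integral>\<^sup>+\<omega>. ennreal ((p \<omega>)\<^sup>2 * v \<omega>) \<partial>lborel) \<le> ennreal (c\<^sup>2 * (LINT \<omega>|lborel. (p \<omega>)\<^sup>2 * \<phi> \<omega>))"
      using core[OF p] I by (simp add: nnv ennreal_mult)
    show i: "integrable lborel (\<lambda>\<omega>. (p \<omega>)\<^sup>2 * v \<omega>)"
      using le_less_trans[OF le] by (intro integrableI_nonneg) (auto simp: v0)
    show "(LINT \<omega>|lborel. (p \<omega>)\<^sup>2 * v \<omega>) \<le> c\<^sup>2 * (LINT \<omega>|lborel. (p \<omega>)\<^sup>2 * \<phi> \<omega>)"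
      using le I by (subst (asm) nn_integral_eq_integral[OF i]) (auto simp: v0)
  qed
  have "AE \<omega> in lborel. 0 \<le> c\<^sup>2 * \<phi> \<omega> - v \<omega>"
  proof (rule AE_nonneg_if_multiplier_squares_nonneg[OF _ S])
    have one: "spectral_multiplier (\<lambda>\<omega>. complex_of_real 1)" using spectral_multiplier_one by simp
    show "integrable lborel (\<lambda>\<omega>. c\<^sup>2 * \<phi> \<omega> - v \<omega>)"
      using int[of "\<lambda>_. 1"] intv[OF _ one] by auto
    show "c\<^sup>2 * \<phi> \<omega> - v \<omega> = 0" if "\<omega> \<notin> S" for \<omega> using \<phi>S[OF that] by (simp add: v_def)
    fix p :: "real^'n \<Rightarrow> real"
    assume p: "continuous_on UNIV p" "spectral_multiplier (\<lambda>\<omega>. of_real (p \<omega>))"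
    have "(LINT \<omega>|lborel. (p \<omega>)\<^sup>2 * (c\<^sup>2 * \<phi> \<omega> - v \<omega>)) = (LINT \<omega>|lborel. c\<^sup>2 * ((p \<omega>)\<^sup>2 * \<phi> \<omega>) - (p \<omega>)\<^sup>2 * v \<omega>)"
      by (simp add: right_diff_distrib mult.left_commute)
    also have "\<dots> = c\<^sup>2 * (LINT \<omega>|lborel. (p \<omega>)\<^sup>2 * \<phi> \<omega>) - (LINT \<omega>|lborel. (p \<omega>)\<^sup>2 * v \<omega>)"
      using int[OF p(1)] intv[OF p] by simp
    finally show "0 \<le> (LINT \<omega>|lborel. (p \<omega>)\<^sup>2 * (c\<^sup>2 * \<phi> \<omega> - v \<omega>))" using lev[OF p] by simp
  qed
  with mpos show ?thesis
  proof eventually_elim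
    case (elim \<omega>)
    show ?case
    proof
      assume "\<omega> \<in> S"
      with elim have m0: "0 < m \<omega>" by (simp add: m_def)
      have "\<phi> \<omega> / m \<omega> \<le> c\<^sup>2"
      proof (cases "\<phi> \<omega> = 0")
        case False
        then have "0 < \<phi> \<omega>" using \<phi>0[of \<omega>] by simp
        then show ?thesis using elim m0 by (simp add: v_def power2_eq_square field_simps)
      qed simp
      then have "sqrt (\<phi> \<omega> / m \<omega>) \<le> sqrt (c\<^sup>2)" by (rule real_sqrt_le_mono)
      then show "sqrt (Re (fourier \<Psi> \<omega>) / Re (fourier \<rho> \<omega>)) \<le> c" using C by (simp add: f\<Psi> m_def)
    qed
  qed
qed


section \<open>The norm of the switch\<close>

text \<open>Division is multiplication by the inverse, and the conventions at 0 and \<open>\<infinity>\<close> keep the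
  inverse antitone.\<close>

lemma ennreal_divide_mono:
  fixes a b S I :: ennreal
  assumes "a \<le> S" "I \<le> b"
  shows "a / b \<le> S / I"
proof -
  have "inverse b \<le> inverse I"
  proof (cases "I = 0 \<or> b = top")
    case False
    then obtain x y where xy: "I = ennreal x" "0 < x" "b = ennreal y" "0 \<le> y"
      using assms(2) by (cases I; cases b) (auto simp: top_unique)
    then have "x \<le> y" using assms(2) by simp
    with xy show ?thesis by (simp add: inverse_ennreal ennreal_leI)
  qed auto
  then show ?thesis
    unfolding divide_ennreal_def using assms(1) by (intro mult_mono) auto
qed

theorem proposition4p2:
  fixes \<tau> :: real and \<rho>_mod :: "real ^ 'n \<Rightarrow> complex"
  assumes "\<tau> > 0"
    and "translation_invariant_kernel \<rho>_mod"
    and "AE \<omega> in lborel. \<omega> \<in> low_freq \<tau> \<longrightarrow> fourier \<rho>_mod \<omega> \<noteq> 0"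
  shows "C_switch (sinc4 \<tau>) \<rho>_mod
           = esssup_on (low_freq \<tau>)
               (\<lambda>\<omega>. ennreal (sqrt (Re (fourier (sinc4 \<tau>) \<omega>) / Re (fourier \<rho>_mod \<omega>))))
       \<and> esssup_on (low_freq \<tau>)
             (\<lambda>\<omega>. ennreal (sqrt (Re (fourier (sinc4 \<tau>) \<omega>) / Re (fourier \<rho>_mod \<omega>))))
           \<le> esssup_on (low_freq \<tau>) (\<lambda>\<omega> :: real ^ 'n. ennreal (sqrt (Re (fourier (sinc4 \<tau>) \<omega>))))
             / essinf_on (low_freq \<tau>) (\<lambda>\<omega>. ennreal (sqrt (Re (fourier \<rho>_mod \<omega>))))
       \<and> (essinf_on (low_freq \<tau>) (\<lambda>\<omega>. ennreal (Re (fourier \<rho>_mod \<omega>))) > 0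
           \<longrightarrow> C_switch (sinc4 \<tau>) \<rho>_mod < \<infinity>
             \<and> rkhs_continuously_embeds (sinc4 \<tau>) \<rho>_mod)"
proof -
  let ?\<Psi> = "sinc4 \<tau> :: real^'n \<Rightarrow> complex"
  let ?\<phi> = "\<lambda>\<omega>. Re (fourier ?\<Psi> \<omega>)" and ?m = "\<lambda>\<omega>. Re (fourier \<rho>_mod \<omega>)"
  let ?ratio = "\<lambda>\<omega>. ennreal (sqrt (?\<phi> \<omega> / ?m \<omega>))"
  let ?K = "esssup_on (low_freq \<tau>) ?ratio"
  have \<Psi>: "integrable lborel ?\<Psi>" "square_integrable ?\<Psi>"
    by (rule integrable_sinc4 square_integrable_sinc4, fact)+
  have f\<Psi>: "fourier ?\<Psi> = fourier_integral ?\<Psi>" using \<Psi>(1) by (rule fourier_integrable)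
  have \<phi>0: "0 \<le> ?\<phi> \<omega>" for \<omega> unfolding f\<Psi> by (rule spectrum_sinc4) fact
  have \<phi>S: "?\<phi> \<omega> = 0" if "\<omega> \<notin> low_freq \<tau>" for \<omega>
    unfolding f\<Psi> using spectrum_sinc4(3)[OF assms(1) that] by simp
  have [measurable]: "?\<phi> \<in> borel_measurable borel" 
    using borel_measurable_fourier[OF \<Psi>(2)] by measurable
  have [measurable]: "?m \<in> borel_measurable borel"
    using assms(2) by (rule translation_invariant_kernelD)
  have mpos: "AE \<omega> in lborel. \<omega> \<in> low_freq \<tau> \<longrightarrow> 0 < ?m \<omega>"
    using assms(3) translation_invariant_kernelD(2)[OF assms(2)]
    by eventually_elim (auto simp: complex_eq_iff less_le)
  have restr: "f \<in> borel_measurable (restrict_space lborel (low_freq \<tau>))"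
    if "f \<in> borel_measurable borel" for f :: "real^'n \<Rightarrow> ennreal"
    using that by (intro measurable_restrict_space1) simp
  have K_le: "?K \<le> ennreal c" if "AE \<omega> in lborel. \<omega> \<in> low_freq \<tau> \<longrightarrow> sqrt (?\<phi> \<omega> / ?m \<omega>) \<le> c" for c
    using that by (intro esssup_I restr) (auto simp: AE_low_freq_iff ennreal_leI elim: eventually_mono)
  have bounded: "rkhs_norm_sq \<rho>_mod g \<le> ennreal (k\<^sup>2) * rkhs_norm_sq ?\<Psi> g"
    if K: "?K = ennreal k" "0 \<le> k" and g: "g \<in> rkhs ?\<Psi>" for k g
  proof (rule rkhs_norm_sq_le[OF \<open>0 \<le> k\<close> g])
    have "AE \<omega> in lborel. \<omega> \<in> low_freq \<tau> \<longrightarrow> ?ratio \<omega> \<le> ennreal k"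
      using esssup_AE[of ?ratio "restrict_space lborel (low_freq \<tau>)"] unfolding K(1) AE_low_freq_iff .
    with mpos show "AE \<omega> in lborel. 0 < ?\<phi> \<omega> \<longrightarrow> 0 < ?m \<omega> \<and> ?\<phi> \<omega> \<le> k\<^sup>2 * ?m \<omega>"
    proof eventually_elim
      case (elim \<omega>)
      show ?case
      proof
        assume "0 < ?\<phi> \<omega>"
        then have "\<omega> \<in> low_freq \<tau>" using \<phi>S by force
        with elim have m: "0 < ?m \<omega>" and "sqrt (?\<phi> \<omega> / ?m \<omega>) \<le> k" using K(2) by auto
        then have "?\<phi> \<omega> / ?m \<omega> \<le> k\<^sup>2" by (metis real_le_rsqrt real_sqrt_le_iff real_sqrt_unique K(2) real_sqrt_abs abs_of_nonneg)
        with m show "0 < ?m \<omega> \<and> ?\<phi> \<omega> \<le> k\<^sup>2 * ?m \<omega>" by (simp add: field_simps)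
      qed
    qed
  qed measurable
  have upper: "C_switch ?\<Psi> \<rho>_mod \<le> ?K \<and> rkhs_continuously_embeds ?\<Psi> \<rho>_mod" if fin: "?K < \<infinity>"
  proof -
    obtain k where k: "?K = ennreal k" "0 \<le> k" using fin by (cases ?K) auto
    show ?thesis using C_switch_le[OF k(2) bounded[OF k]] k(1) by simp
  qed
  have lower: "?K \<le> C_switch ?\<Psi> \<rho>_mod"
  proof (cases "C_switch ?\<Psi> \<rho>_mod")
    case (real c)
    have "AE \<omega> in lborel. \<omega> \<in> low_freq \<tau> \<longrightarrow> sqrt (?\<phi> \<omega> / ?m \<omega>) \<le> c"
      using real spectrum_sinc4[OF assms(1)] mpos
      by (intro spectral_ratio_le_C_switch \<Psi> compact_low_freq) auto
    from K_le[OF this] show ?thesis using real by simp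
  qed simp
  have eq: "C_switch ?\<Psi> \<rho>_mod = ?K"
    using upper lower by (cases "?K < \<infinity>") (auto simp: less_top[symmetric] top_unique)
  have split: "?K \<le> esssup_on (low_freq \<tau>) (\<lambda>\<omega> :: real ^ 'n. ennreal (sqrt (?\<phi> \<omega>)))
             / essinf_on (low_freq \<tau>) (\<lambda>\<omega>. ennreal (sqrt (?m \<omega>)))" (is "_ \<le> ?A / ?B")
  proof (rule esssup_I)
    have "AE \<omega> in restrict_space lborel (low_freq \<tau>). ennreal (sqrt (?\<phi> \<omega>)) \<le> ?A" by (rule esssup_AE)
    moreover have "AE \<omega> in restrict_space lborel (low_freq \<tau>). ?B \<le> ennreal (sqrt (?m \<omega>))" by (rule essinf_AE)
    moreover have "AE \<omega> in restrict_space lborel (low_freq \<tau>). 0 < ?m \<omega>" using mpos by (simp add: AE_low_freq_iff)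
    ultimately show "AE \<omega> in restrict_space lborel (low_freq \<tau>). ?ratio \<omega> \<le> ?A / ?B"
    proof eventually_elim
      case (elim \<omega>)
      have "?ratio \<omega> = ennreal (sqrt (?\<phi> \<omega>)) / ennreal (sqrt (?m \<omega>))"
        using elim \<phi>0 by (simp add: real_sqrt_divide divide_ennreal)
      also have "\<dots> \<le> ?A / ?B" using elim by (intro ennreal_divide_mono)
      finally show ?case .
    qed
  qed (intro restr, measurable)
  have finite: "?K < \<infinity>" if pos: "essinf_on (low_freq \<tau>) (\<lambda>\<omega>. ennreal (?m \<omega>)) > 0"
  proof -
    obtain d where d: "0 < d" "d < essinf_on (low_freq \<tau>) (\<lambda>\<omega>. ennreal (?m \<omega>))"
      using dense[OF pos] by blast
    then obtain \<delta> where \<delta>: "d = ennreal \<delta>" "0 < \<delta>" by (cases d) (auto simp: ennreal_less_zero_iff)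
    define B where "B = (LINT z|lborel. cmod (?\<Psi> z))"
    have B: "?\<phi> \<omega> \<le> B" for \<omega>
      unfolding f\<Psi> B_def using cmod_fourier_integral_le complex_Re_le_cmod order_trans by blast
    have "AE \<omega> in lborel. \<omega> \<in> low_freq \<tau> \<longrightarrow> essinf_on (low_freq \<tau>) (\<lambda>\<omega>. ennreal (?m \<omega>)) \<le> ennreal (?m \<omega>)"
      unfolding AE_low_freq_iff[symmetric] by (rule essinf_AE)
    with mpos have "AE \<omega> in lborel. \<omega> \<in> low_freq \<tau> \<longrightarrow> sqrt (?\<phi> \<omega> / ?m \<omega>) \<le> sqrt (B / \<delta>)"
    proof eventually_elim
      case (elim \<omega>)
      show ?case
      proof
        assume "\<omega> \<in> low_freq \<tau>"
        with elim have m: "0 < ?m \<omega>"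
          and "essinf_on (low_freq \<tau>) (\<lambda>\<omega>. ennreal (?m \<omega>)) \<le> ennreal (?m \<omega>)" by auto
        then have "ennreal \<delta> \<le> ennreal (?m \<omega>)"
          using d(2) unfolding \<delta>(1) by (meson less_imp_le order_trans)
        then have "\<delta> \<le> ?m \<omega>" using m by simp
        then show "sqrt (?\<phi> \<omega> / ?m \<omega>) \<le> sqrt (B / \<delta>)"
          using \<delta> B \<phi>0 by (intro real_sqrt_le_mono frac_le) (auto intro: order_trans)
      qed
    qed
    from K_le[OF this] show ?thesis by (simp add: le_less_trans)
  qed
  show ?thesis using eq split finite upper by auto
qed

end
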